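(* Let $G$ be a Lie group with Lie algebra $\mathfrak{g}$, let $\ell:2\mathfrak{g}\to\mathbb{R}$ be a reduced second-order Lagrangian, let $h>0$, $N\ge1$, let $(a_{ij})_{i,j=1}^s$, $(b_i)_{i=1}^s$ be Runge--Kutta coefficients with all $b_i\neq0$, and let $\tau:\mathfrak{g}\to G$ be a local approximation of the exponential map. Let $\gamma\in\mathcal{C}_d$ be a solution of the discrete HOHP principle for the functional \begin{align*}S=h\sum_{k=0}^{N-1}\Big\{&\sum_{i=1}^s\Big[b_i\ell(\Xi_k^i,V_k^i)+\Big\langle\mu_k^i,\tfrac1h\tau^{-1}(g_k^{-1}G_k^i)-\sum_{j=1}^sa_{ij}\Xi_k^j\Big\rangle+\Big\langle\nu_k^i,\tfrac1h(\Xi_k^i-\xi_k)-\sum_{j=1}^sa_{ij}V_k^j\Big\rangle\Big]\\&+\Big\langle\check\mu_{k+1},\tfrac1h\tau^{-1}(g_k^{-1}g_{k+1})-\sum_{i=1}^sb_i\Xi_k^i\Big\rangle+\Big\langle\nu_{k+1},\tfrac1h(\xi_{k+1}-\xi_k)-\sum_{i=1}^sb_iV_k^i\Big\rangle\Big\}.\end{align*} Then, for $k=0,\dots,N-1$ and $i=1,\dots,s$, the following hold: the reconstruction equations $$\Xi_k^i=\xi_k+h\sum_{j}a_{ij}V_k^j,\quad G_k^i=g_k\tau\Big(h\sum_ja_{ij}\Xi_k^j\Big),\quad \xi_{k+1}=\xi_k+h\sum_jb_jV_k^j,\quad g_{k+1}=g_k\tau\Big(h\sum_jb_j\Xi_k^j\Big);$$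 the auxiliary equations $$\mu_k^i=0,\qquad \nu_{k+1}=\nu_k-\sum_{j}\nu_k^j;$$ the equations for the discrete Ostrogradsky momenta $$\frac{\delta\ell}{\delta\xi}(\Xi_k^i,V_k^i)=(d\tau_{-h\Xi_{k+1}})^*\mu_{k+1}-\frac{1}{hb_i}\nu_k^i,\qquad \frac{\delta\ell}{\delta u}(\Xi_k^i,V_k^i)=\sum_j\Big(\frac{a_{ji}}{b_i}-1\Big)\nu_k^j+\nu_k;$$ and the discrete Euler--Poincar\'e equation $$\mu_{k+1}=(d\tau^{-1}_{-h\Xi_{k+1}})^*(d\tau_{h\Xi_{k+1}})^*\mu_k.$$
   Context: $2\mathfrak{g}=\mathfrak{g}\times\mathfrak{g}$, $\ell=\ell(\xi,u)$ is smooth (it arises from a left-invariant Lagrangian on the second-order tangent bundle of $G$). The map $\tau$ is an analytic diffeomorphism from a neighbourhood of $0\in\mathfrak{g}$ onto a neighbourhood of $e\in G$, with $\tau(0)=e$ and $\tau(-\eta)\tau(\eta)=e$; its right-trivialised differential is $d\tau_\xi:\mathfrak{g}\to\mathfrak{g}$, $d\tau_\xi(\eta)=(T_\xi\tau(\eta))\tau(\xi)^{-1}$, with inverse $d\tau_\xi^{-1}$. All arguments of $\tau$, $\tau^{-1}$ are assumed to lie in these neighbourhoods. The discrete path space is $\mathcal{C}_d=(G\times\mathfrak{g})\times(G\times\mathfrak{g}\times2\mathfrak{g}^* )^N\times(G\times2\mathfrak{g}\times2\mathfrak{g}^* )^{Ns}$, with elements $$\gamma=\big\{(g_0,\xi_0),(g_k,\xi_k,\check\mu_k,\nu_k)_{k=1}^N,(G_k^i,\Xi_k^i,V_k^i,\mu_k^i,\nu_k^i)_{1\le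 i\le s,\,0\le k\le N-1}\big\}.$$ $\gamma$ is a solution of the discrete HOHP principle if $dS(\delta\gamma)=0$ for all $\delta\gamma\in T_\gamma\mathcal{C}_d$ with $\delta g_0=\delta g_N=0$ and $\delta\xi_0=\delta\xi_N=0$. Notation: $\Xi_{k+1}=\sum_jb_j\Xi_k^j$, $\Theta_k^i=\sum_ja_{ij}\Xi_k^j$, $\mu_k=(d\tau^{-1}_{-h\Xi_k})^*\check\mu_k$ for $k=1,\dots,N$, $\nu_0=\nu_1+\sum_i\nu_0^i$, and $\mu_0=(d\tau^{-1}_{h\Xi_1})^*\check\mu_1+\sum_i(d\tau^{-1}_{h\Theta_0^i})^*\mu_0^i$. *)

theory Defs
  imports "HOL-Analysis.Analysis"
begin

section \<open>Smooth and real-analytic maps on open subsets of normed spaces\<close>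

text \<open>All spaces below are finite-dimensional (this is required in \<open>lie_group\<close>), so that
  continuity of all iterated directional derivatives amounts to \<open>C\<^sup>k\<close> in the usual sense.
  The class \<open>real_normed_vector\<close> is used rather than \<open>euclidean_space\<close> because the latter
  excludes dimension 0.\<close>

fun Ck_on :: "nat \<Rightarrow> 'a::real_normed_vector set \<Rightarrow> ('a \<Rightarrow> 'b::real_normed_vector) \<Rightarrow> bool" where
  "Ck_on 0 W f \<longleftrightarrow> continuous_on W f"
| "Ck_on (Suc k) W f \<longleftrightarrow> (\<forall>x\<in>W. f differentiable (at x)) \<and>
     (\<forall>v. Ck_on k W (\<lambda>x. frechet_derivative f (at x) v))"

definition smooth_map_on :: "'a::real_normed_vector set \<Rightarrow> ('a \<Rightarrow> 'b::real_normed_vector) \<Rightarrow> bool" where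
  "smooth_map_on W f \<longleftrightarrow> (\<forall>k. Ck_on k W f)"

text \<open>Local expansion into a multivariate power series in the coordinates of some linear basis;
  \<open>has_sum\<close> is unconditional summation over the set of all multi-indices \<open>\<alpha>\<close>.\<close>

definition power_series_on :: "'a::real_normed_vector set \<Rightarrow> ('a \<Rightarrow> 'b::real_normed_vector) \<Rightarrow> bool" where
  "power_series_on W f \<longleftrightarrow>
     (\<forall>x\<in>W. \<exists>B r. \<exists>c :: ('a \<Rightarrow> nat) \<Rightarrow> 'b.
        finite B \<and> independent B \<and> span B = UNIV \<and> r > 0 \<and>
        (\<forall>y\<in>W \<inter> ball x r.
           ((\<lambda>\<alpha>. (\<Prod>b\<in>B. representation B (y - x) b ^ \<alpha> b) *\<^sub>R c \<alpha>) has_sum f y)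
             {\<alpha>. \<forall>b. b \<notin> B \<longrightarrow> \<alpha> b = 0}))"

datatype regularity = Smooth | Analytic

fun regular_on :: "regularity \<Rightarrow> 'a::real_normed_vector set \<Rightarrow> ('a \<Rightarrow> 'b::real_normed_vector) \<Rightarrow> bool" where
  "regular_on Smooth W f \<longleftrightarrow> smooth_map_on W f"
| "regular_on Analytic W f \<longleftrightarrow> smooth_map_on W f \<and> power_series_on W f"


section \<open>Manifolds given by atlases\<close>

type_synonym ('a, 'e) chart = "'a set \<times> ('a \<Rightarrow> 'e)"

definition is_chart :: "('a::topological_space, 'e::real_normed_vector) chart \<Rightarrow> bool" where
  "is_chart = (\<lambda>(U, \<phi>). open U \<and> open (\<phi> ` U) \<and> homeomorphism U (\<phi> ` U) \<phi> (inv_into U \<phi>))"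

definition is_atlas ::
  "regularity \<Rightarrow> ('a::topological_space, 'e::real_normed_vector) chart set \<Rightarrow> bool" where
  "is_atlas r A \<longleftrightarrow>
     (\<forall>c\<in>A. is_chart c) \<and> (\<Union>c\<in>A. fst c) = UNIV \<and>
     (\<forall>(U, \<phi>)\<in>A. \<forall>(V, \<psi>)\<in>A. regular_on r (\<phi> ` (U \<inter> V)) (\<psi> \<circ> inv_into U \<phi>))"

definition vec_atlas :: "('v, 'v) chart set" where
  "vec_atlas = {(UNIV, id)}"

definition product_atlas ::
  "('a, 'e) chart set \<Rightarrow> ('b, 'f) chart set \<Rightarrow> ('a \<times> 'b, 'e \<times> 'f) chart set" where
  "product_atlas A B = {(U \<times> V, map_prod \<phi> \<psi>) | U \<phi> V \<psi>. (U, \<phi>) \<in> A \<and> (V, \<psi>) \<in> B}"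

definition regular_map ::
  "regularity \<Rightarrow> ('a::topological_space, 'e::real_normed_vector) chart set \<Rightarrow> 'a set \<Rightarrow>
   ('b::topological_space, 'f::real_normed_vector) chart set \<Rightarrow> ('a \<Rightarrow> 'b) \<Rightarrow> bool" where
  "regular_map r A W B f \<longleftrightarrow>
     continuous_on W f \<and>
     (\<forall>(U, \<phi>)\<in>A. \<forall>(V, \<psi>)\<in>B.
        regular_on r (\<phi> ` (U \<inter> W \<inter> f -` V)) (\<psi> \<circ> f \<circ> inv_into U \<phi>))"


section \<open>Tangent vectors as velocity classes of curves\<close>

text \<open>Curves are functions on all of \<open>real\<close>, but only their germ at 0 matters.\<close>

definition curve_at ::
  "('a::topological_space, 'e::real_normed_vector) chart set \<Rightarrow> 'a \<Rightarrow> (real \<Rightarrow> 'a) \<Rightarrow> bool" where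
  "curve_at A p c \<longleftrightarrow>
     c 0 = p \<and> isCont c 0 \<and> (\<forall>(U, \<phi>)\<in>A. p \<in> U \<longrightarrow> (\<phi> \<circ> c) differentiable (at 0))"

definition tangent_rel ::
  "('a::topological_space, 'e::real_normed_vector) chart set \<Rightarrow> 'a \<Rightarrow> (real \<Rightarrow> 'a) rel" where
  "tangent_rel A p = {(c, d). curve_at A p c \<and> curve_at A p d \<and>
     (\<forall>(U, \<phi>)\<in>A. p \<in> U \<longrightarrow>
        vector_derivative (\<phi> \<circ> c) (at 0) = vector_derivative (\<phi> \<circ> d) (at 0))}"

definition tangent_space ::
  "('a::topological_space, 'e::real_normed_vector) chart set \<Rightarrow> 'a \<Rightarrow> (real \<Rightarrow> 'a) set set" where
  "tangent_space A p = {c. curve_at A p c} // tangent_rel A p"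

definition tangent_vec ::
  "('a::topological_space, 'e::real_normed_vector) chart set \<Rightarrow> (real \<Rightarrow> 'a) \<Rightarrow> (real \<Rightarrow> 'a) set" where
  "tangent_vec A c = tangent_rel A (c 0) `` {c}"

text \<open>The union is over representatives: for differentiable \<open>f\<close> all its members coincide.\<close>

definition tangent_map ::
  "('b::topological_space, 'f::real_normed_vector) chart set \<Rightarrow> ('a \<Rightarrow> 'b) \<Rightarrow>
   (real \<Rightarrow> 'a) set \<Rightarrow> (real \<Rightarrow> 'b) set" where
  "tangent_map B f v = (\<Union>c\<in>v. tangent_vec B (f \<circ> c))"


section \<open>Lie groups and their Lie algebras\<close>

record ('a, 'e) lie_data =
  gmult :: "'a \<Rightarrow> 'a \<Rightarrow> 'a"
  gunit :: "'a"
  ginv :: "'a \<Rightarrow> 'a"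
  atlas :: "('a, 'e) chart set"

definition lie_group ::
  "regularity \<Rightarrow> ('a::{t2_space, second_countable_topology}, 'e::real_normed_vector) lie_data \<Rightarrow> bool" where
  "lie_group r G \<longleftrightarrow>
     (\<exists>B :: 'e set. finite B \<and> span B = UNIV) \<and>
     Groups.group (gmult G) (gunit G) (ginv G) \<and>
     is_atlas r (atlas G) \<and>
     regular_map r (product_atlas (atlas G) (atlas G)) UNIV (atlas G) (\<lambda>(x, y). gmult G x y) \<and>
     regular_map r (atlas G) UNIV (atlas G) (ginv G)"

text \<open>The Lie algebra is a vector space \<open>'g\<close> with a linear isomorphism \<open>\<theta>\<close> onto the tangent
  space at the unit, whose linear structure is the one read off in charts. The norm on \<open>'g\<close>
  is auxiliary (any norm will do), and the bracket plays no role in what follows.\<close>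

definition lie_algebra_iso ::
  "('a::{t2_space, second_countable_topology}, 'e::real_normed_vector) lie_data \<Rightarrow>
   ('g::real_normed_vector \<Rightarrow> (real \<Rightarrow> 'a) set) \<Rightarrow> bool" where
  "lie_algebra_iso G \<theta> \<longleftrightarrow>
     bij_betw \<theta> UNIV (tangent_space (atlas G) (gunit G)) \<and>
     (\<forall>(U, \<phi>)\<in>atlas G. gunit G \<in> U \<longrightarrow>
        (\<exists>L. linear L \<and>
             (\<forall>\<eta>. \<forall>c\<in>\<theta> \<eta>. ((\<phi> \<circ> c) has_vector_derivative L \<eta>) (at 0))))"


section \<open>Local approximations of the exponential map\<close>

text \<open>Analyticity refers to the analytic structure of the Lie group: an atlas \<open>B\<close> which is
  smoothly compatible with the given one and makes the group operations analytic.\<close>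

definition local_exp_approx ::
  "('a::{t2_space, second_countable_topology}, 'e::real_normed_vector) lie_data \<Rightarrow>
   'g::real_normed_vector set \<Rightarrow> ('g \<Rightarrow> 'a) \<Rightarrow> bool" where
  "local_exp_approx G D \<tau> \<longleftrightarrow>
     open D \<and> 0 \<in> D \<and> open (\<tau> ` D) \<and> inj_on \<tau> D \<and>
     (\<exists>B. is_atlas Smooth (atlas G \<union> B) \<and> lie_group Analytic (G\<lparr>atlas := B\<rparr>) \<and>
          regular_map Analytic vec_atlas D B \<tau> \<and>
          regular_map Analytic B (\<tau> ` D) vec_atlas (inv_into D \<tau>)) \<and>
     \<tau> 0 = gunit G \<and>
     (\<forall>\<eta>\<in>D. - \<eta> \<in> D \<longrightarrow> gmult G (\<tau> (- \<eta>)) (\<tau> \<eta>) = gunit G)"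

text \<open>\<open>d\<tau>\<^sub>\<xi>(\<eta>) = (T\<^sub>\<xi>\<tau>(\<eta>)) \<tau>(\<xi>)\<^sup>-\<^sup>1\<close>, transported to \<open>'g\<close> by \<open>\<theta>\<close>; the argument of the inner
  \<open>tangent_map\<close> is the tangent vector \<open>\<eta>\<close> at \<open>\<xi>\<close>.\<close>

definition dtau ::
  "('a::{t2_space, second_countable_topology}, 'e::real_normed_vector) lie_data \<Rightarrow>
   ('g::real_normed_vector \<Rightarrow> (real \<Rightarrow> 'a) set) \<Rightarrow> ('g \<Rightarrow> 'a) \<Rightarrow> 'g \<Rightarrow> 'g \<Rightarrow> 'g" where
  "dtau G \<theta> \<tau> \<xi> \<eta> =
     inv \<theta> (tangent_map (atlas G) (\<lambda>x. gmult G x (ginv G (\<tau> \<xi>)))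
              (tangent_map (atlas G) \<tau> (tangent_vec vec_atlas (\<lambda>t. \<xi> + t *\<^sub>R \<eta>))))"

definition dtau_inv ::
  "('a::{t2_space, second_countable_topology}, 'e::real_normed_vector) lie_data \<Rightarrow>
   ('g::real_normed_vector \<Rightarrow> (real \<Rightarrow> 'a) set) \<Rightarrow> ('g \<Rightarrow> 'a) \<Rightarrow> 'g \<Rightarrow> 'g \<Rightarrow> 'g" where
  "dtau_inv G \<theta> \<tau> \<xi> = inv (dtau G \<theta> \<tau> \<xi>)"

text \<open>The dual space is \<open>'g \<Rightarrow>\<^sub>L real\<close>; \<open>dual_map L\<close> is \<open>L\<^sup>*\<close>.\<close>

definition dual_map ::
  "('v::real_normed_vector \<Rightarrow> 'w::real_normed_vector) \<Rightarrow> ('w \<Rightarrow>\<^sub>L real) \<Rightarrow> ('v \<Rightarrow>\<^sub>L real)" where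
  "dual_map L \<mu> = Blinfun (\<lambda>\<eta>. blinfun_apply \<mu> (L \<eta>))"

definition dl_dxi :: "('g::real_normed_vector \<times> 'g \<Rightarrow> real) \<Rightarrow> 'g \<Rightarrow> 'g \<Rightarrow> ('g \<Rightarrow>\<^sub>L real)" where
  "dl_dxi l \<xi> u = Blinfun (frechet_derivative (\<lambda>x. l (x, u)) (at \<xi>))"

definition dl_du :: "('g::real_normed_vector \<times> 'g \<Rightarrow> real) \<Rightarrow> 'g \<Rightarrow> 'g \<Rightarrow> ('g \<Rightarrow>\<^sub>L real)" where
  "dl_du l \<xi> u = Blinfun (frechet_derivative (\<lambda>x. l (\<xi>, x)) (at u))"


section \<open>Discrete paths and the discrete action\<close>

text \<open>Only the values at the following indices are meaningful: \<open>g k\<close>, \<open>xi k\<close> for \<open>k \<le> N\<close>;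
  \<open>cmu k\<close>, \<open>nu k\<close> for \<open>1 \<le> k \<le> N\<close>; the stage variables at \<open>k i\<close> for \<open>k < N\<close>, \<open>1 \<le> i \<le> s\<close>.\<close>

record (overloaded) ('a, 'g::real_normed_vector) path =
  g :: "nat \<Rightarrow> 'a"
  xi :: "nat \<Rightarrow> 'g"
  cmu :: "nat \<Rightarrow> ('g \<Rightarrow>\<^sub>L real)"
  nu :: "nat \<Rightarrow> ('g \<Rightarrow>\<^sub>L real)"
  Gs :: "nat \<Rightarrow> nat \<Rightarrow> 'a"
  Xis :: "nat \<Rightarrow> nat \<Rightarrow> 'g"
  Vs :: "nat \<Rightarrow> nat \<Rightarrow> 'g"
  mus :: "nat \<Rightarrow> nat \<Rightarrow> ('g \<Rightarrow>\<^sub>L real)"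
  nus :: "nat \<Rightarrow> nat \<Rightarrow> ('g \<Rightarrow>\<^sub>L real)"

definition action ::
  "('a::{t2_space, second_countable_topology}, 'e::real_normed_vector) lie_data \<Rightarrow>
   'g::real_normed_vector set \<Rightarrow> ('g \<Rightarrow> 'a) \<Rightarrow> ('g \<times> 'g \<Rightarrow> real) \<Rightarrow> real \<Rightarrow> nat \<Rightarrow>
   nat \<Rightarrow> (nat \<Rightarrow> nat \<Rightarrow> real) \<Rightarrow> (nat \<Rightarrow> real) \<Rightarrow> ('a, 'g) path \<Rightarrow> real" where
  "action G D \<tau> l h N s a b \<gamma> =
     h * (\<Sum>k<N.
       (\<Sum>i=1..s.
          b i * l (Xis \<gamma> k i, Vs \<gamma> k i)
        + blinfun_apply (mus \<gamma> k i)
            ((1 / h) *\<^sub>R inv_into D \<tau> (gmult G (ginv G (g \<gamma> k)) (Gs \<gamma> k i))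
              - (\<Sum>j=1..s. a i j *\<^sub>R Xis \<gamma> k j))
        + blinfun_apply (nus \<gamma> k i)
            ((1 / h) *\<^sub>R (Xis \<gamma> k i - xi \<gamma> k) - (\<Sum>j=1..s. a i j *\<^sub>R Vs \<gamma> k j)))
     + blinfun_apply (cmu \<gamma> (k + 1))
         ((1 / h) *\<^sub>R inv_into D \<tau> (gmult G (ginv G (g \<gamma> k)) (g \<gamma> (k + 1)))
           - (\<Sum>i=1..s. b i *\<^sub>R Xis \<gamma> k i))
     + blinfun_apply (nu \<gamma> (k + 1))
         ((1 / h) *\<^sub>R (xi \<gamma> (k + 1) - xi \<gamma> k) - (\<Sum>i=1..s. b i *\<^sub>R Vs \<gamma> k i)))"

definition path_curve ::
  "('a::{t2_space, second_countable_topology}, 'e::real_normed_vector) lie_data \<Rightarrow> nat \<Rightarrow> nat \<Rightarrow>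
   ('a, 'g::real_normed_vector) path \<Rightarrow> (real \<Rightarrow> ('a, 'g) path) \<Rightarrow> bool" where
  "path_curve G N s \<gamma> \<Gamma> \<longleftrightarrow>
     \<Gamma> 0 = \<gamma> \<and>
     (\<forall>k\<le>N. curve_at (atlas G) (g \<gamma> k) (\<lambda>t. g (\<Gamma> t) k) \<and>
            (\<lambda>t. xi (\<Gamma> t) k) differentiable (at 0)) \<and>
     (\<forall>k\<in>{1..N}. (\<lambda>t. cmu (\<Gamma> t) k) differentiable (at 0) \<and>
                (\<lambda>t. nu (\<Gamma> t) k) differentiable (at 0)) \<and>
     (\<forall>k<N. \<forall>i\<in>{1..s}.
        curve_at (atlas G) (Gs \<gamma> k i) (\<lambda>t. Gs (\<Gamma> t) k i) \<and>
        (\<lambda>t. Xis (\<Gamma> t) k i) differentiable (at 0) \<and>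
        (\<lambda>t. Vs (\<Gamma> t) k i) differentiable (at 0) \<and>
        (\<lambda>t. mus (\<Gamma> t) k i) differentiable (at 0) \<and>
        (\<lambda>t. nus (\<Gamma> t) k i) differentiable (at 0))"

text \<open>The velocity of the curve \<open>\<Gamma>\<close> satisfies \<open>\<delta>g\<^sub>0 = \<delta>g\<^sub>N = 0\<close> and \<open>\<delta>\<xi>\<^sub>0 = \<delta>\<xi>\<^sub>N = 0\<close>.
  The zero tangent vector is the class of a constant curve.\<close>

definition fixed_ends ::
  "('a::{t2_space, second_countable_topology}, 'e::real_normed_vector) lie_data \<Rightarrow> nat \<Rightarrow>
   ('a, 'g::real_normed_vector) path \<Rightarrow> (real \<Rightarrow> ('a, 'g) path) \<Rightarrow> bool" where
  "fixed_ends G N \<gamma> \<Gamma> \<longleftrightarrow>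
     (\<forall>k\<in>{0, N}.
        tangent_vec (atlas G) (\<lambda>t. g (\<Gamma> t) k) = tangent_vec (atlas G) (\<lambda>t. g \<gamma> k) \<and>
        ((\<lambda>t. xi (\<Gamma> t) k) has_vector_derivative 0) (at 0))"

text \<open>Tangent vectors \<open>\<delta>\<gamma>\<close> are velocities of curves \<open>\<Gamma>\<close> through \<open>\<gamma>\<close>, and \<open>dS(\<delta>\<gamma>)\<close> is the
  derivative of \<open>S \<circ> \<Gamma>\<close> at 0.\<close>

definition discrete_HOHP_solution ::
  "('a::{t2_space, second_countable_topology}, 'e::real_normed_vector) lie_data \<Rightarrow>
   'g::real_normed_vector set \<Rightarrow> ('g \<Rightarrow> 'a) \<Rightarrow> ('g \<times> 'g \<Rightarrow> real) \<Rightarrow> real \<Rightarrow> nat \<Rightarrow>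
   nat \<Rightarrow> (nat \<Rightarrow> nat \<Rightarrow> real) \<Rightarrow> (nat \<Rightarrow> real) \<Rightarrow> ('a, 'g) path \<Rightarrow> bool" where
  "discrete_HOHP_solution G D \<tau> l h N s a b \<gamma> \<longleftrightarrow>
     (\<forall>\<Gamma>. path_curve G N s \<gamma> \<Gamma> \<and> fixed_ends G N \<gamma> \<Gamma> \<longrightarrow>
        ((\<lambda>t. action G D \<tau> l h N s a b (\<Gamma> t)) has_real_derivative 0) (at 0))"


section \<open>Derived quantities\<close>

text \<open>\<open>Xi_node b s \<gamma> k\<close> is \<open>\<Xi>\<^sub>k\<close>, meaningful for \<open>k \<ge> 1\<close>.\<close>

definition Xi_node :: "(nat \<Rightarrow> real) \<Rightarrow> nat \<Rightarrow> ('a, 'g::real_normed_vector) path \<Rightarrow> nat \<Rightarrow> 'g" where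
  "Xi_node b s \<gamma> k = (\<Sum>j=1..s. b j *\<^sub>R Xis \<gamma> (k - 1) j)"

definition Theta ::
  "(nat \<Rightarrow> nat \<Rightarrow> real) \<Rightarrow> nat \<Rightarrow> ('a, 'g::real_normed_vector) path \<Rightarrow> nat \<Rightarrow> nat \<Rightarrow> 'g" where
  "Theta a s \<gamma> k i = (\<Sum>j=1..s. a i j *\<^sub>R Xis \<gamma> k j)"

definition arguments_in_domain ::
  "('a::{t2_space, second_countable_topology}, 'e::real_normed_vector) lie_data \<Rightarrow>
   'g::real_normed_vector set \<Rightarrow> ('g \<Rightarrow> 'a) \<Rightarrow> real \<Rightarrow> nat \<Rightarrow>
   nat \<Rightarrow> (nat \<Rightarrow> nat \<Rightarrow> real) \<Rightarrow> (nat \<Rightarrow> real) \<Rightarrow> ('a, 'g) path \<Rightarrow> bool" where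
  "arguments_in_domain G D \<tau> h N s a b \<gamma> \<longleftrightarrow>
     (\<forall>k<N. gmult G (ginv G (g \<gamma> k)) (g \<gamma> (k + 1)) \<in> \<tau> ` D \<and>
            h *\<^sub>R Xi_node b s \<gamma> (k + 1) \<in> D \<and> - (h *\<^sub>R Xi_node b s \<gamma> (k + 1)) \<in> D \<and>
            (\<forall>i\<in>{1..s}. gmult G (ginv G (g \<gamma> k)) (Gs \<gamma> k i) \<in> \<tau> ` D \<and>
                        h *\<^sub>R Theta a s \<gamma> k i \<in> D))"

definition mu_node ::
  "('a::{t2_space, second_countable_topology}, 'e::real_normed_vector) lie_data \<Rightarrow>
   ('g::real_normed_vector \<Rightarrow> (real \<Rightarrow> 'a) set) \<Rightarrow> ('g \<Rightarrow> 'a) \<Rightarrow> real \<Rightarrow>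
   nat \<Rightarrow> (nat \<Rightarrow> nat \<Rightarrow> real) \<Rightarrow> (nat \<Rightarrow> real) \<Rightarrow> ('a, 'g) path \<Rightarrow> nat \<Rightarrow> ('g \<Rightarrow>\<^sub>L real)" where
  "mu_node G \<theta> \<tau> h s a b \<gamma> k =
     (if k = 0 then
        dual_map (dtau_inv G \<theta> \<tau> (h *\<^sub>R Xi_node b s \<gamma> 1)) (cmu \<gamma> 1)
        + (\<Sum>i=1..s. dual_map (dtau_inv G \<theta> \<tau> (h *\<^sub>R Theta a s \<gamma> 0 i)) (mus \<gamma> 0 i))
      else dual_map (dtau_inv G \<theta> \<tau> (- (h *\<^sub>R Xi_node b s \<gamma> k))) (cmu \<gamma> k))"

definition nu_node :: "nat \<Rightarrow> ('a, 'g::real_normed_vector) path \<Rightarrow> nat \<Rightarrow> ('g \<Rightarrow>\<^sub>L real)" where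
  "nu_node s \<gamma> k = (if k = 0 then nu \<gamma> 1 + (\<Sum>i=1..s. nus \<gamma> 0 i) else nu \<gamma> k)"

end

theory Submission
  imports Defs
begin

text \<open>
  All equations come from curves through \<open>\<gamma>\<close> that move few variables at a time. Varying a
  Lagrange multiplier gives a constraint, since on a finite-dimensional space the bounded
  functionals separate points. For the group variables the curves are \<open>g \<tau>(\<xi> + t v)\<close>, along which
  one \<open>\<tau>\<^sup>-\<^sup>1\<close>-term of the action is affine in \<open>t\<close>. Varying a stage point \<open>G\<^sub>k\<^sup>i\<close> in this way kills
  \<open>\<mu>\<^sub>k\<^sup>i\<close>. Varying an interior node \<open>g\<^sub>k\<close> meets two consecutive \<open>\<tau>\<^sup>-\<^sup>1\<close>-terms; as
  \<open>\<tau>(\<xi> + t v)\<^sup>-\<^sup>1 = \<tau>(- \<xi> - t v)\<close>, the second one has derivative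
  \<open>- d\<tau>\<^sup>-\<^sup>1\<^sub>\<zeta> (d\<tau>\<^sub>-\<^sub>\<xi> v)\<close>, so no adjoint representation is needed, and the balance of the two is the
  discrete Euler-Poincare equation.
\<close>

text \<open>A tangent vector is a class of curves and \<open>tangent_map\<close> is a union over
  representatives, so even the linearity of \<open>dtau\<close> is not visible in its definition.
  The work before the variational argument shows that tangency of curves survives the group
  multiplication, \<open>\<tau>\<close> and its inverse, and that one linear map gives the velocity
  of \<open>F \<circ> p\<close> for all curves \<open>p\<close> through a point. Two features shape
  it: the regularity of \<open>\<tau>\<close> refers to an analytic atlas that is only smoothly
  compatible with \<open>atlas G\<close>, and \<open>inv_into D \<tau>\<close> is meaningful only on
  the image of \<open>D\<close>, so that identities between curves hold only near parameter 0. In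
  the variational part the order matters. Moving a node also moves the stage terms of the following
  step, and their contribution disappears because the \<open>mus\<close> are known to vanish by
  then. No variation is available at the fixed node 0; the values of \<open>mu_node\<close> and
  \<open>nu_node\<close> there are defined so that the equations of the interior nodes continue to
  \<open>k = 0\<close>.\<close>

section \<open>Finite-dimensional normed spaces\<close>

text \<open>Coordinates with respect to a finite independent set are bounded. In the induction step
  the bound for \<open>S\<close> makes coefficients of convergent sequences Cauchy, so
  \<open>span S\<close> is closed; hence \<open>v\<close> has positive distance from it, and this
  distance controls the coefficient of \<open>v\<close>.\<close>

lemma independent_coeffs_bounded:
  fixes S :: "'a::real_normed_vector set"
  assumes "finite S" "independent S"
  shows "\<exists>K\<ge>0. \<forall>c :: 'a \<Rightarrow> real. (\<Sum>b\<in>S. \<bar>c b\<bar>) \<le> K * norm (\<Sum>b\<in>S. c b *\<^sub>R b)"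
  using assms
proof (induction S)
  case empty
  show ?case by (intro exI[of _ 0]) auto
next
  case (insert v S)
  have ind: "independent S" and v: "v \<notin> span S"
    using insert.prems insert.hyps by (auto simp: independent_insert)
  obtain K where K0: "K \<ge> 0" and K: "\<And>c :: 'a \<Rightarrow> real. (\<Sum>b\<in>S. \<bar>c b\<bar>) \<le> K * norm (\<Sum>b\<in>S. c b *\<^sub>R b)"
    using insert.IH[OF ind] by blast
  have "closed (span S)"
    unfolding closed_sequential_limits
  proof (intro allI impI, elim conjE)
    fix x :: "nat \<Rightarrow> 'a" and y
    assume xS: "\<forall>n. x n \<in> span S" and xy: "x \<longlonglongrightarrow> y"
    have "\<forall>n. \<exists>c. x n = (\<Sum>b\<in>S. c b *\<^sub>R b)"
      using xS span_finite[OF insert.hyps(1)] by auto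
    then obtain c where c: "\<And>n. x n = (\<Sum>b\<in>S. c n b *\<^sub>R b)"
      by metis
    have "convergent (\<lambda>n. c n b)" if b: "b \<in> S" for b
    proof -
      have bound: "\<bar>c m b - c n b\<bar> \<le> K * norm (x m - x n)" for m n
      proof -
        have "\<bar>c m b - c n b\<bar> \<le> (\<Sum>b\<in>S. \<bar>c m b - c n b\<bar>)"
          using b insert.hyps(1) by (intro member_le_sum) auto
        also have "\<dots> \<le> K * norm (\<Sum>b\<in>S. (c m b - c n b) *\<^sub>R b)" by (rule K)
        also have "(\<Sum>b\<in>S. (c m b - c n b) *\<^sub>R b) = x m - x n"
          by (simp add: c scaleR_left_diff_distrib sum_subtractf)
        finally show ?thesis .
      qed
      have "Cauchy (\<lambda>n. c n b)"
      proof (rule metric_CauchyI)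
        fix e :: real assume e: "e > 0"
        \<comment> \<open>The constant \<open>K\<close> may be 0, hence the tolerance with
          \<open>K + 1\<close> in the denominator.\<close>
        obtain M where M: "\<And>m n. m \<ge> M \<Longrightarrow> n \<ge> M \<Longrightarrow> dist (x m) (x n) < e / (K + 1)"
          using metric_CauchyD[OF LIMSEQ_imp_Cauchy[OF xy], of "e / (K + 1)"] e K0 by auto
        have "dist (c m b) (c n b) < e" if "m \<ge> M" "n \<ge> M" for m n
        proof -
          have "\<bar>c m b - c n b\<bar> \<le> (K + 1) * norm (x m - x n)"
            using bound[of m n] by (simp add: algebra_simps add_increasing)
          also have "\<dots> < (K + 1) * (e / (K + 1))"
            using M[OF that] K0 by (intro mult_strict_left_mono) (auto simp: dist_norm)
          finally show ?thesis using K0 by (simp add: dist_real_def)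
        qed
        then show "\<exists>M. \<forall>m\<ge>M. \<forall>n\<ge>M. dist (c m b) (c n b) < e" by blast
      qed
      then show ?thesis by (simp add: Cauchy_convergent_iff)
    qed
    then obtain d where d: "\<And>b. b \<in> S \<Longrightarrow> (\<lambda>n. c n b) \<longlonglongrightarrow> d b"
      unfolding convergent_def by metis
    have "x \<longlonglongrightarrow> (\<Sum>b\<in>S. d b *\<^sub>R b)"
      unfolding c by (intro tendsto_sum tendsto_scaleR d tendsto_const)
    then have "y = (\<Sum>b\<in>S. d b *\<^sub>R b)" using xy LIMSEQ_unique by blast
    then show "y \<in> span S" by (simp add: span_sum span_scale span_base)
  qed
  then have pos: "infdist v (span S) > 0"
    using v infdist_pos_not_in_closed[of "span S" v] span_zero by blast
  define d where "d = infdist v (span S)"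
  have d0: "d > 0" using pos by (simp add: d_def)
  have line: "\<bar>t\<bar> * d \<le> norm (t *\<^sub>R v + w)" if w: "w \<in> span S" for t w
  proof (cases "t = 0")
    case False
    have "- ((1 / t) *\<^sub>R w) \<in> span S" using w by (simp add: span_neg span_scale)
    then have "d \<le> dist v (- ((1 / t) *\<^sub>R w))" unfolding d_def by (rule infdist_le)
    then have "\<bar>t\<bar> * d \<le> \<bar>t\<bar> * norm (v + (1 / t) *\<^sub>R w)"
      by (intro mult_left_mono) (auto simp: dist_norm)
    also have "\<dots> = norm (t *\<^sub>R (v + (1 / t) *\<^sub>R w))" by simp
    also have "t *\<^sub>R (v + (1 / t) *\<^sub>R w) = t *\<^sub>R v + w"
      using False by (simp add: scaleR_add_right)
    finally show ?thesis .
  qed simp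
  \<comment> \<open>The summand \<open>1 / d\<close> bounds the coefficient of \<open>v\<close>. The
    rest bounds those of \<open>S\<close> through \<open>K\<close>, since removing the
    \<open>v\<close>-component enlarges the norm at most by the factor
    \<open>1 + norm v / d\<close>.\<close>
  define C where "C = K * (1 + norm v / d) + 1 / d"
  have "(\<Sum>b\<in>insert v S. \<bar>c b\<bar>) \<le> C * norm (\<Sum>b\<in>insert v S. c b *\<^sub>R b)" for c :: "'a \<Rightarrow> real"
  proof -
    define w where "w = (\<Sum>b\<in>S. c b *\<^sub>R b)"
    define X where "X = norm (c v *\<^sub>R v + w)"
    have "w \<in> span S" by (simp add: w_def span_sum span_scale span_base)
    then have cv: "\<bar>c v\<bar> \<le> X / d"
      using line[of w "c v"] d0 by (simp add: X_def field_simps)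
    have "norm w \<le> X + norm (c v *\<^sub>R v)"
      unfolding X_def using norm_triangle_ineq4[of "c v *\<^sub>R v + w" "c v *\<^sub>R v"] by simp
    also have "\<dots> \<le> X + (X / d) * norm v"
      using mult_right_mono[OF cv, of "norm v"] by simp
    finally have w: "norm w \<le> X * (1 + norm v / d)" by (simp add: algebra_simps)
    have "(\<Sum>b\<in>S. \<bar>c b\<bar>) \<le> K * (X * (1 + norm v / d))"
      using K[of c] mult_left_mono[OF w K0] unfolding w_def by linarith
    then have "\<bar>c v\<bar> + (\<Sum>b\<in>S. \<bar>c b\<bar>) \<le> C * X"
      using cv by (simp add: C_def algebra_simps)
    then show ?thesis
      using insert.hyps by (simp add: X_def w_def)
  qed
  moreover have "C \<ge> 0" using K0 d0 by (simp add: C_def)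
  ultimately show ?case by blast
qed

text \<open>\<open>Blinfun\<close> has its intended value only on bounded linear maps, so every
  functional built below from a linear map passes through this fact.\<close>

lemma linear_imp_bounded_linear_finite_dim:
  fixes f :: "'a::real_normed_vector \<Rightarrow> 'b::real_normed_vector"
  assumes f: "linear f" and S: "finite S" "span S = (UNIV :: 'a set)"
  shows "bounded_linear f"
proof -
  obtain B where B: "B \<subseteq> S" "independent B" "span B = span S"
    using maximal_independent_subset[of S] by (metis span_minimal span_superset subset_antisym span_eq subspace_span span_mono)
  have finB: "finite B" using B S finite_subset by blast
  obtain K where K0: "K \<ge> 0" and K: "\<And>c :: 'a \<Rightarrow> real. (\<Sum>b\<in>B. \<bar>c b\<bar>) \<le> K * norm (\<Sum>b\<in>B. c b *\<^sub>R b)"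
    using independent_coeffs_bounded[OF finB B(2)] by blast
  define M where "M = (\<Sum>b\<in>B. norm (f b))"
  have "norm (f x) \<le> norm x * (K * M)" for x
  proof -
    have "x \<in> span B" using B S by simp
    then obtain c where c: "x = (\<Sum>b\<in>B. c b *\<^sub>R b)"
      using span_finite[OF finB] by auto
    have "norm (f x) = norm (\<Sum>b\<in>B. c b *\<^sub>R f b)"
      by (simp add: c linear_sum[OF f] linear_cmul[OF f])
    also have "\<dots> \<le> (\<Sum>b\<in>B. \<bar>c b\<bar> * norm (f b))"
      by (rule order_trans[OF norm_sum]) simp
    also have "\<dots> \<le> (\<Sum>b\<in>B. \<bar>c b\<bar> * M)"
      unfolding M_def using finB by (intro sum_mono mult_left_mono member_le_sum) auto
    also have "\<dots> = (\<Sum>b\<in>B. \<bar>c b\<bar>) * M" by (simp add: sum_distrib_right)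
    also have "\<dots> \<le> (K * norm x) * M"
      unfolding c by (intro mult_right_mono K) (simp add: M_def sum_nonneg)
    finally show ?thesis by (simp add: mult_ac)
  qed
  then show ?thesis
    using f by (intro bounded_linear_intro[where K = "K * M"]) (auto simp: linear_add linear_cmul)
qed

text \<open>A linear functional with value 1 at a nonzero \<open>x\<close> exists by algebra alone
  and is bounded because the dimension is finite.\<close>

lemma blinfun_separates_points_finite_dim:
  fixes x :: "'a::real_normed_vector"
  assumes S: "finite S" "span S = (UNIV :: 'a set)"
    and x: "\<And>m :: 'a \<Rightarrow>\<^sub>L real. blinfun_apply m x = 0"
  shows "x = 0"
proof (rule ccontr)
  assume "x \<noteq> 0"
  then have "independent {x}" by simp
  then obtain f :: "'a \<Rightarrow> real" where f: "linear f" "f x = 1"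
    using linear_independent_extend[of "{x}" "\<lambda>_. 1 :: real"] by auto
  have "blinfun_apply (Blinfun f) x = 1"
    using linear_imp_bounded_linear_finite_dim[OF f(1) S] f(2) by (simp add: bounded_linear_Blinfun_apply)
  with x show False by simp
qed

section \<open>Differentiable maps into manifolds\<close>

text \<open>This is \<open>curve_at\<close> with the real parameter replaced by a vector variable
  and with an arbitrary base point, so that curves and \<open>\<tau>\<close> itself fall under the
  same chain rules.\<close>

definition mdiff ::
  "('a::topological_space, 'e::real_normed_vector) chart set \<Rightarrow> ('v::real_normed_vector \<Rightarrow> 'a) \<Rightarrow> 'v \<Rightarrow> bool" where
  "mdiff A F x \<longleftrightarrow> isCont F x \<and> (\<forall>(U, \<phi>)\<in>A. F x \<in> U \<longrightarrow> (\<phi> \<circ> F) differentiable (at x))"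

text \<open>The part of an atlas that the chain rules need. It passes to
  \<open>product_atlas\<close> without any discussion of transition maps on products.\<close>

definition chart_cover :: "('a::topological_space, 'e::real_normed_vector) chart set \<Rightarrow> bool" where
  "chart_cover A \<longleftrightarrow> (\<forall>(U, \<phi>)\<in>A. open U \<and> inj_on \<phi> U) \<and> (\<Union>c\<in>A. fst c) = UNIV"

lemma curve_at_iff_mdiff: "curve_at A p c \<longleftrightarrow> c 0 = p \<and> mdiff A c 0"
  by (auto simp: curve_at_def mdiff_def)

lemma chart_cover_obtain:
  assumes "chart_cover A"
  obtains U \<phi> where "(U, \<phi>) \<in> A" "p \<in> U" "open U" "inj_on \<phi> U"
proof -
  have "p \<in> (\<Union>c\<in>A. fst c)" using assms by (simp add: chart_cover_def)
  then obtain U \<phi> where "(U, \<phi>) \<in> A" "p \<in> U" by force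
  with assms that show thesis by (auto simp: chart_cover_def)
qed

lemma chart_coverD: "chart_cover A \<Longrightarrow> (U, \<phi>) \<in> A \<Longrightarrow> open U \<and> inj_on \<phi> U"
  by (auto simp: chart_cover_def)

lemma is_atlas_imp_chart_cover:
  assumes "is_atlas r A"
  shows "chart_cover A"
proof -
  have "open U \<and> inj_on \<phi> U" if "(U, \<phi>) \<in> A" for U \<phi>
  proof -
    have "is_chart (U, \<phi>)" using assms that by (auto simp: is_atlas_def)
    then have o: "open U" and hm: "homeomorphism U (\<phi> ` U) \<phi> (inv_into U \<phi>)"
      by (auto simp: is_chart_def)
    show ?thesis using o homeomorphism_apply1[OF hm] by (metis inj_on_inverseI)
  qed
  then show ?thesis using assms by (auto simp: chart_cover_def is_atlas_def)
qed

lemma chart_cover_vec_atlas: "chart_cover vec_atlas"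
  by (simp add: chart_cover_def vec_atlas_def)

lemma chart_cover_product_atlas:
  assumes A: "chart_cover A" and B: "chart_cover B"
  shows "chart_cover (product_atlas A B)"
proof -
  have "open W \<and> inj_on \<kappa> W" if "(W, \<kappa>) \<in> product_atlas A B" for W \<kappa>
    using that chart_coverD[OF A] chart_coverD[OF B]
    by (auto simp: product_atlas_def intro!: open_Times map_prod_inj_on)
  moreover have "(x, y) \<in> (\<Union>c\<in>product_atlas A B. fst c)" for x y
  proof -
    obtain U \<phi> where U: "(U, \<phi>) \<in> A" "x \<in> U" using chart_cover_obtain[OF A] .
    obtain V \<psi> where V: "(V, \<psi>) \<in> B" "y \<in> V" using chart_cover_obtain[OF B] .
    have "(U \<times> V, map_prod \<phi> \<psi>) \<in> product_atlas A B" using U V by (auto simp: product_atlas_def)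
    then show ?thesis using U V by force
  qed
  ultimately show ?thesis by (auto simp: chart_cover_def)
qed

lemma smooth_map_on_differentiable:
  assumes "smooth_map_on W f" "x \<in> W"
  shows "f differentiable (at x)"
proof -
  have "Ck_on (Suc 0) W f" using assms(1) unfolding smooth_map_on_def by blast
  then show ?thesis using assms(2) by simp
qed

lemma regular_on_differentiable: "regular_on r W f \<Longrightarrow> x \<in> W \<Longrightarrow> f differentiable (at x)"
  by (cases r) (auto intro: smooth_map_on_differentiable)

lemma regular_map_chart_differentiable:
  assumes "regular_map r A W B f" "(U, \<phi>) \<in> A" "(V, \<psi>) \<in> B" "p \<in> U" "p \<in> W" "f p \<in> V"
  shows "(\<psi> \<circ> f \<circ> inv_into U \<phi>) differentiable (at (\<phi> p))"
proof -
  have "regular_on r (\<phi> ` (U \<inter> W \<inter> f -` V)) (\<psi> \<circ> f \<circ> inv_into U \<phi>)"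
    using assms by (auto simp: regular_map_def)
  then show ?thesis using assms by (intro regular_on_differentiable) auto
qed

lemma eventually_in_open:
  assumes "isCont F x" "open U" "F x \<in> U"
  shows "\<forall>\<^sub>F y in nhds x. F y \<in> U"
proof -
  have "\<forall>\<^sub>F y in at x. F y \<in> U" using topological_tendstoD[OF isContD[OF assms(1)] assms(2,3)] .
  then show ?thesis using assms(3) by (auto simp: eventually_at_filter elim: eventually_mono)
qed

text \<open>By continuity \<open>F\<close> stays in the chart domain near \<open>x\<close>, so
  \<open>f \<circ> F\<close> factors there through the chart. The resulting derivative depends on
  \<open>F\<close> only through \<open>F'\<close>, which is what makes velocities
  comparable.\<close>

lemma chart_chain_rule:
  fixes F :: "'v::real_normed_vector \<Rightarrow> 'a::topological_space"
  assumes U: "open U" "inj_on \<phi> U" "F x \<in> U" and F: "isCont F x" "((\<phi> \<circ> F) has_derivative F') (at x)"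
    and f: "(f \<circ> inv_into U \<phi>) differentiable (at (\<phi> (F x)))"
  shows "((f \<circ> F) has_derivative
    (\<lambda>v. frechet_derivative (f \<circ> inv_into U \<phi>) (at (\<phi> (F x))) (F' v))) (at x)"
proof -
  have "((f \<circ> inv_into U \<phi>) has_derivative frechet_derivative (f \<circ> inv_into U \<phi>) (at (\<phi> (F x))))
      (at ((\<phi> \<circ> F) x))"
    using f frechet_derivative_works[THEN iffD1, OF f] by simp
  from diff_chain_at[OF F(2) this]
  have D: "((f \<circ> inv_into U \<phi>) \<circ> (\<phi> \<circ> F) has_derivative
    (\<lambda>v. frechet_derivative (f \<circ> inv_into U \<phi>) (at (\<phi> (F x))) (F' v))) (at x)"
    by (simp add: o_def)
  have "\<forall>\<^sub>F y in nhds x. F y \<in> U" using eventually_in_open[OF F(1) U(1) U(3)] .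
  then have "\<forall>\<^sub>F y in at x. ((f \<circ> inv_into U \<phi>) \<circ> (\<phi> \<circ> F)) y = (f \<circ> F) y"
    unfolding eventually_at_filter by eventually_elim (simp add: inv_into_f_f[OF U(2)])
  then show ?thesis
    by (rule has_derivative_transform_eventually[OF D]) (simp_all add: U inv_into_f_f[OF U(2)])
qed

lemma vector_derivative_eq_frechet:
  fixes c :: "real \<Rightarrow> 'a::real_normed_vector"
  assumes "(c has_derivative M) (at t)"
  shows "vector_derivative c (at t) = M 1"
proof -
  have "linear M" using assms has_derivative_bounded_linear bounded_linear.linear by blast
  then have "M u = u *\<^sub>R M 1" for u using linear_cmul[of M u 1] by simp
  then have "M = (\<lambda>u. u *\<^sub>R M 1)" by (rule ext)
  then have "(c has_vector_derivative M 1) (at t)"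
    using assms unfolding has_vector_derivative_def by metis
  then show ?thesis by (rule vector_derivative_at)
qed

text \<open>The same matrix transports the chart velocities of all curves through a point.\<close>

lemma chart_chain_rule_velocity:
  fixes c :: "real \<Rightarrow> 'a::topological_space"
  assumes "open U" "inj_on \<phi> U" "c 0 = p" "p \<in> U" "isCont c 0" "(\<phi> \<circ> c) differentiable (at 0)"
    and "(f \<circ> inv_into U \<phi>) differentiable (at (\<phi> p))"
  shows "vector_derivative (f \<circ> c) (at 0) =
    frechet_derivative (f \<circ> inv_into U \<phi>) (at (\<phi> p)) (vector_derivative (\<phi> \<circ> c) (at 0))"
proof -
  obtain M where M: "((\<phi> \<circ> c) has_derivative M) (at 0)"
    using assms(6) by (auto simp: differentiable_def)
  show ?thesis
    using chart_chain_rule[of U \<phi> c 0, OF assms(1,2) _ assms(5) M, of f] assms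
    by (simp add: vector_derivative_eq_frechet[OF M] vector_derivative_eq_frechet)
qed

lemma mdiff_compose:
  fixes F :: "'v::real_normed_vector \<Rightarrow> 'a::t2_space"
  assumes A: "chart_cover A" and f: "regular_map r A W B f"
    and W: "open W" "F x \<in> W" and F: "mdiff A F x"
  shows "mdiff B (f \<circ> F) x"
proof -
  obtain U \<phi> where U: "(U, \<phi>) \<in> A" "F x \<in> U" "open U" "inj_on \<phi> U" using chart_cover_obtain[OF A] .
  have cF: "isCont F x" and "(\<phi> \<circ> F) differentiable (at x)" using F U by (auto simp: mdiff_def)
  then obtain F' where F': "((\<phi> \<circ> F) has_derivative F') (at x)" by (auto simp: differentiable_def)
  have "continuous_on W f" using f by (simp add: regular_map_def)
  then have "isCont f (F x)" using W by (simp add: continuous_on_eq_continuous_at)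
  then have "isCont (f \<circ> F) x" using cF by (intro continuous_at_compose)
  moreover have "(\<psi> \<circ> (f \<circ> F)) differentiable (at x)" if V: "(V, \<psi>) \<in> B" "f (F x) \<in> V" for V \<psi>
    using chart_chain_rule[OF U(3,4,2) cF F', of "\<psi> \<circ> f"]
      regular_map_chart_differentiable[OF f U(1) V(1) U(2) W(2) V(2)]
    by (auto simp: differentiable_def o_assoc)
  ultimately show ?thesis by (auto simp: mdiff_def)
qed

text \<open>Compatibility of charts restated as regularity of the identity. Changing the chart
  within one atlas and passing between compatible atlases both become cases of composition.\<close>

lemma regular_map_id:
  assumes "is_atlas r C" "A \<subseteq> C" "B \<subseteq> C"
  shows "regular_map r A UNIV B (\<lambda>x. x)"
proof -
  have "regular_on r (\<phi> ` (U \<inter> V)) (\<psi> \<circ> inv_into U \<phi>)"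
    if "(U, \<phi>) \<in> A" "(V, \<psi>) \<in> B" for U \<phi> V \<psi>
  proof -
    have "(U, \<phi>) \<in> C" "(V, \<psi>) \<in> C" using assms that by auto
    then show ?thesis using assms(1) unfolding is_atlas_def by blast
  qed
  then show ?thesis by (auto simp: regular_map_def o_def)
qed

lemma mdiff_chart:
  assumes A: "is_atlas r A" and U: "(U, \<phi>) \<in> A" "F x \<in> U"
    and F: "isCont F x" "(\<phi> \<circ> F) differentiable (at x)"
  shows "mdiff A F x"
proof -
  have o: "open U" "inj_on \<phi> U" using is_atlas_imp_chart_cover[OF A] U chart_coverD by blast+
  obtain F' where F': "((\<phi> \<circ> F) has_derivative F') (at x)" using F by (auto simp: differentiable_def)
  have "(\<psi> \<circ> F) differentiable (at x)" if V: "(V, \<psi>) \<in> A" "F x \<in> V" for V \<psi>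
    using chart_chain_rule[OF o U(2) F(1) F', of \<psi>]
      regular_map_chart_differentiable[OF regular_map_id[OF A order_refl order_refl] U(1) V(1) U(2) UNIV_I V(2)]
    by (auto simp: differentiable_def o_def)
  then show ?thesis using F by (auto simp: mdiff_def)
qed

lemma mdiff_Pair:
  assumes F: "mdiff A F x" and H: "mdiff B H x"
  shows "mdiff (product_atlas A B) (\<lambda>y. (F y, H y)) x"
proof -
  have "(map_prod \<phi> \<psi> \<circ> (\<lambda>y. (F y, H y))) differentiable (at x)"
    if "(U, \<phi>) \<in> A" "(V, \<psi>) \<in> B" "F x \<in> U" "H x \<in> V" for U \<phi> V \<psi>
  proof -
    have "(\<phi> \<circ> F) differentiable (at x)" "(\<psi> \<circ> H) differentiable (at x)"
      using F H that by (auto simp: mdiff_def)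
    then show ?thesis
      unfolding differentiable_def by (auto simp: o_def intro!: has_derivative_Pair)
  qed
  then show ?thesis using F H by (auto simp: mdiff_def product_atlas_def intro!: continuous_Pair)
qed

lemma mdiff_vec_atlas: "mdiff vec_atlas F x \<longleftrightarrow> F differentiable (at x)"
  by (auto simp: mdiff_def vec_atlas_def differentiable_imp_continuous_within)

lemma mdiff_const: "mdiff A (\<lambda>_. p) x"
  by (auto simp: mdiff_def o_def)

lemma mdiff_compose_vec:
  assumes "mdiff A F (p x)" "p differentiable (at x)"
  shows "mdiff A (F \<circ> p) x"
proof -
  have "isCont p x" using assms(2) by (rule differentiable_imp_continuous_within)
  then show ?thesis
    using assms unfolding mdiff_def
    by (auto intro!: continuous_at_compose simp: o_assoc intro: differentiable_chain_at)
qed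

lemma mdiff_cong:
  fixes A :: "('a::topological_space, 'e::real_normed_vector) chart set"
  assumes F: "mdiff A F x" and eq: "\<forall>\<^sub>F y in nhds x. H y = F y"
  shows "mdiff A H x"
proof -
  have Hx: "H x = F x" using eq eventually_nhds_x_imp_x by blast
  have "isCont H x" using F isCont_cong[OF eq] by (simp add: mdiff_def)
  moreover have "(\<phi> \<circ> H) differentiable (at x)" if d: "(\<phi> \<circ> F) differentiable (at x)" for \<phi> :: "'a \<Rightarrow> 'e"
  proof -
    obtain F' where F': "((\<phi> \<circ> F) has_derivative F') (at x)" using d by (auto simp: differentiable_def)
    have "\<forall>\<^sub>F y in at x. (\<phi> \<circ> F) y = (\<phi> \<circ> H) y"
      using eq by (auto simp: eventually_at_filter elim: eventually_mono)
    then have "((\<phi> \<circ> H) has_derivative F') (at x)"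
      by (intro has_derivative_transform_eventually[OF F']) (auto simp: Hx)
    then show ?thesis by (auto simp: differentiable_def)
  qed
  ultimately show ?thesis using F Hx by (auto simp: mdiff_def)
qed

section \<open>Velocity classes\<close>

lemma equiv_tangent_rel: "equiv {c. curve_at A p c} (tangent_rel A p)"
  by (intro equivI refl_onI symI transI) (fastforce simp: tangent_rel_def)+

lemma tangent_relD: "(c, d) \<in> tangent_rel A p \<Longrightarrow> curve_at A p c \<and> curve_at A p d"
  by (simp add: tangent_rel_def)

text \<open>Velocities in any other chart arise from those in \<open>\<phi>\<close> by the
  derivative of the transition map, so agreement in one chart suffices.\<close>

lemma tangent_rel_chart:
  assumes A: "is_atlas r A" and U: "(U, \<phi>) \<in> A" "p \<in> U"
    and cd: "curve_at A p c" "curve_at A p d"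
    and eq: "vector_derivative (\<phi> \<circ> c) (at 0) = vector_derivative (\<phi> \<circ> d) (at 0)"
  shows "(c, d) \<in> tangent_rel A p"
proof -
  have o: "open U" "inj_on \<phi> U" using is_atlas_imp_chart_cover[OF A] U chart_coverD by blast+
  have "vector_derivative (\<psi> \<circ> c) (at 0) = vector_derivative (\<psi> \<circ> d) (at 0)"
    if V: "(V, \<psi>) \<in> A" "p \<in> V" for V \<psi>
  proof -
    have D: "(\<psi> \<circ> inv_into U \<phi>) differentiable (at (\<phi> p))"
      using regular_map_chart_differentiable[OF regular_map_id[OF A order_refl order_refl] U(1) V(1) U(2) UNIV_I V(2)]
      by (simp add: o_def)
    show ?thesis
      using chart_chain_rule_velocity[OF o _ U(2) _ _ D, of c] chart_chain_rule_velocity[OF o _ U(2) _ _ D, of d]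
        cd U eq by (fastforce simp: curve_at_def)
  qed
  then show ?thesis using cd by (auto simp: tangent_rel_def)
qed

text \<open>This is the well-definedness of the tangent map: in charts, one and the same derivative
  of \<open>f\<close> acts on the velocities of \<open>c\<close> and of \<open>d\<close>.\<close>

lemma tangent_rel_compose:
  fixes c d :: "real \<Rightarrow> 'a::t2_space"
  assumes A: "chart_cover A" and f: "regular_map r A W B f" and W: "open W" "p \<in> W"
    and cd: "(c, d) \<in> tangent_rel A p"
  shows "(f \<circ> c, f \<circ> d) \<in> tangent_rel B (f p)"
proof -
  obtain U \<phi> where U: "(U, \<phi>) \<in> A" "p \<in> U" "open U" "inj_on \<phi> U" using chart_cover_obtain[OF A] .
  have c: "curve_at A p c" and d: "curve_at A p d" using tangent_relD[OF cd] by auto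
  have eq: "vector_derivative (\<phi> \<circ> c) (at 0) = vector_derivative (\<phi> \<circ> d) (at 0)"
    using cd U by (auto simp: tangent_rel_def)
  have "vector_derivative (\<psi> \<circ> (f \<circ> c)) (at 0) = vector_derivative (\<psi> \<circ> (f \<circ> d)) (at 0)"
    if V: "(V, \<psi>) \<in> B" "f p \<in> V" for V \<psi>
  proof -
    have D: "((\<psi> \<circ> f) \<circ> inv_into U \<phi>) differentiable (at (\<phi> p))"
      using regular_map_chart_differentiable[OF f U(1) V(1) U(2) W(2) V(2)] .
    show ?thesis
      using chart_chain_rule_velocity[OF U(3,4) _ U(2) _ _ D, of c]
        chart_chain_rule_velocity[OF U(3,4) _ U(2) _ _ D, of d] c d U eq
      by (fastforce simp: curve_at_def o_assoc)
  qed
  moreover have "curve_at B (f p) (f \<circ> c)" "curve_at B (f p) (f \<circ> d)"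
    using c d W mdiff_compose[OF A f W(1), of c 0] mdiff_compose[OF A f W(1), of d 0]
    by (auto simp: curve_at_iff_mdiff)
  ultimately show ?thesis by (auto simp: tangent_rel_def)
qed

lemma vector_derivative_Pair:
  assumes "c differentiable (at t)" "d differentiable (at t)"
  shows "vector_derivative (\<lambda>u. (c u, d u)) (at t) = (vector_derivative c (at t), vector_derivative d (at t))"
  using assms by (intro vector_derivative_at has_vector_derivative_Pair)
    (auto simp: vector_derivative_works)

lemma tangent_rel_Pair:
  assumes "(c, d) \<in> tangent_rel A p" "(c', d') \<in> tangent_rel B q"
  shows "(\<lambda>t. (c t, c' t), \<lambda>t. (d t, d' t)) \<in> tangent_rel (product_atlas A B) (p, q)"
proof -
  have cu: "curve_at A p c" "curve_at A p d" "curve_at B q c'" "curve_at B q d'"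
    using assms by (auto simp: tangent_rel_def)
  have "vector_derivative (map_prod \<phi> \<psi> \<circ> (\<lambda>t. (c t, c' t))) (at 0)
      = vector_derivative (map_prod \<phi> \<psi> \<circ> (\<lambda>t. (d t, d' t))) (at 0)"
    if "(U, \<phi>) \<in> A" "(V, \<psi>) \<in> B" "p \<in> U" "q \<in> V" for U \<phi> V \<psi>
  proof -
    have "(\<phi> \<circ> c) differentiable (at 0)" "(\<phi> \<circ> d) differentiable (at 0)"
      "(\<psi> \<circ> c') differentiable (at 0)" "(\<psi> \<circ> d') differentiable (at 0)"
      using cu that by (auto simp: curve_at_def)
    moreover have "vector_derivative (\<phi> \<circ> c) (at 0) = vector_derivative (\<phi> \<circ> d) (at 0)"
      "vector_derivative (\<psi> \<circ> c') (at 0) = vector_derivative (\<psi> \<circ> d') (at 0)"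
      using assms that by (auto simp: tangent_rel_def)
    ultimately show ?thesis by (simp add: o_def vector_derivative_Pair)
  qed
  moreover have "curve_at (product_atlas A B) (p, q) (\<lambda>t. (c t, c' t))"
    "curve_at (product_atlas A B) (p, q) (\<lambda>t. (d t, d' t))"
    using cu by (auto simp: curve_at_iff_mdiff intro: mdiff_Pair)
  ultimately show ?thesis by (auto simp: tangent_rel_def product_atlas_def)
qed

lemma tangent_rel_eventually_eq:
  assumes c: "curve_at A p c" and eq: "\<forall>\<^sub>F t in nhds 0. d t = c t"
  shows "(c, d) \<in> tangent_rel A p"
proof -
  have d0: "d 0 = c 0" using eq eventually_nhds_x_imp_x by blast
  have d: "curve_at A p d" using c mdiff_cong[OF _ eq] d0 by (auto simp: curve_at_iff_mdiff)
  have "vector_derivative (\<phi> \<circ> c) (at 0) = vector_derivative (\<phi> \<circ> d) (at 0)" for \<phi> :: "'a \<Rightarrow> 'b"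
    using eq by (intro vector_derivative_cong_eq) (auto elim: eventually_mono)
  then show ?thesis using c d by (auto simp: tangent_rel_def)
qed

lemma tangent_rel_vec_atlas:
  "(c, d) \<in> tangent_rel vec_atlas p \<longleftrightarrow> c 0 = p \<and> d 0 = p \<and> c differentiable (at 0) \<and>
    d differentiable (at 0) \<and> vector_derivative c (at 0) = vector_derivative d (at 0)"
  by (auto simp: tangent_rel_def curve_at_iff_mdiff mdiff_vec_atlas) (auto simp: vec_atlas_def)

lemma tangent_vec_eq_iff:
  assumes "curve_at A p c" "curve_at A p d"
  shows "tangent_vec A c = tangent_vec A d \<longleftrightarrow> (c, d) \<in> tangent_rel A p"
  using assms eq_equiv_class_iff[OF equiv_tangent_rel, of c A p d]
  by (simp add: tangent_vec_def curve_at_def)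

text \<open>If \<open>f\<close> respects tangency to \<open>c\<close>, all members of the union that
  defines \<open>tangent_map\<close> are one and the same class, and the representative
  \<open>c\<close> shows that the union is not empty.\<close>

lemma tangent_map_tangent_vec:
  assumes c: "curve_at A p c"
    and f: "\<And>d. (c, d) \<in> tangent_rel A p \<Longrightarrow> (f \<circ> c, f \<circ> d) \<in> tangent_rel B (f p)"
  shows "tangent_map B f (tangent_vec A c) = tangent_vec B (f \<circ> c)"
proof -
  have tv: "tangent_vec A c = tangent_rel A p `` {c}" using c by (simp add: tangent_vec_def curve_at_def)
  have "c \<in> tangent_vec A c" using equiv_class_self[OF equiv_tangent_rel] c unfolding tv by blast
  moreover have "tangent_vec B (f \<circ> d) = tangent_vec B (f \<circ> c)" if "d \<in> tangent_vec A c" for d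
  proof -
    have "(f \<circ> c, f \<circ> d) \<in> tangent_rel B (f p)" using that tv f by auto
    then show ?thesis using tangent_relD tangent_vec_eq_iff by metis
  qed
  ultimately show ?thesis unfolding tangent_map_def by blast
qed

section \<open>The right-trivialised differential\<close>

lemma has_vector_derivative_line:
  "((\<lambda>t. x + t *\<^sub>R v) has_vector_derivative v) (at s)"
  by (auto intro!: derivative_eq_intros)

locale lie_exp_approx =
  fixes G :: "('a::{t2_space, second_countable_topology}, 'e::real_normed_vector) lie_data"
    and \<theta> :: "'g::real_normed_vector \<Rightarrow> (real \<Rightarrow> 'a) set"
    and D :: "'g set" and \<tau> :: "'g \<Rightarrow> 'a"
  assumes lie: "lie_group Smooth G" and iso: "lie_algebra_iso G \<theta>"
    and approx: "local_exp_approx G D \<tau>"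
begin

sublocale Groups.group "gmult G" "gunit G" "ginv G"
  using lie by (simp add: lie_group_def)

section \<open>Regularity of the group operations, of the map \<open>\<tau>\<close> and of its
  inverse\<close>

lemma atlas: "is_atlas Smooth (atlas G)"
  using lie by (simp add: lie_group_def)

lemma cover: "chart_cover (atlas G)"
  using atlas by (rule is_atlas_imp_chart_cover)

lemma regular_mult: "regular_map Smooth (product_atlas (atlas G) (atlas G)) UNIV (atlas G) (\<lambda>(x, y). gmult G x y)"
  using lie by (simp add: lie_group_def)

lemma mdiff_mult:
  assumes "mdiff (atlas G) F x" "mdiff (atlas G) H x"
  shows "mdiff (atlas G) (\<lambda>y. gmult G (F y) (H y)) x"
  using mdiff_compose[OF chart_cover_product_atlas[OF cover cover] regular_mult open_UNIV UNIV_I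
      mdiff_Pair[OF assms]] by (simp add: o_def)

lemma mdiff_inv:
  assumes "mdiff (atlas G) F x"
  shows "mdiff (atlas G) (\<lambda>y. ginv G (F y)) x"
proof -
  have "regular_map Smooth (atlas G) UNIV (atlas G) (ginv G)" using lie by (simp add: lie_group_def)
  from mdiff_compose[OF cover this open_UNIV UNIV_I assms] show ?thesis by (simp add: o_def)
qed

lemma open_D: "open D" and open_image: "open (\<tau> ` D)" and inj_tau: "inj_on \<tau> D"
  using approx by (auto simp: local_exp_approx_def)

lemma tau_uminus: "\<eta> \<in> D \<Longrightarrow> - \<eta> \<in> D \<Longrightarrow> \<tau> (- \<eta>) = ginv G (\<tau> \<eta>)"
proof -
  assume "\<eta> \<in> D" "- \<eta> \<in> D"
  then have "gmult G (\<tau> (- \<eta>)) (\<tau> \<eta>) = gunit G" using approx by (auto simp: local_exp_approx_def)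
  then show ?thesis by (metis inverse_unique inverse_inverse)
qed

lemma tau_inv_tau [simp]: "\<eta> \<in> D \<Longrightarrow> inv_into D \<tau> (\<tau> \<eta>) = \<eta>"
  by (rule inv_into_f_f[OF inj_tau])

text \<open>The atlas in which \<open>\<tau>\<close> is analytic may differ from
  \<open>atlas G\<close>. The identity is smooth in both directions between them, so statements
  about \<open>\<tau>\<close> and its inverse reach \<open>atlas G\<close> by composition with
  it.\<close>

lemma analytic_atlas:
  "\<exists>B :: ('a, 'e) chart set. chart_cover B \<and> regular_map Analytic vec_atlas D B \<tau> \<and>
    regular_map Analytic B (\<tau> ` D) vec_atlas (inv_into D \<tau>) \<and>
    regular_map Smooth B UNIV (atlas G) (\<lambda>x. x) \<and> regular_map Smooth (atlas G) UNIV B (\<lambda>x. x)"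
proof -
  obtain B where B: "is_atlas Smooth (atlas G \<union> B)" "lie_group Analytic (G\<lparr>atlas := B\<rparr>)"
    "regular_map Analytic vec_atlas D B \<tau>" "regular_map Analytic B (\<tau> ` D) vec_atlas (inv_into D \<tau>)"
    using approx by (auto simp: local_exp_approx_def)
  have "is_atlas Analytic B" using B(2) by (simp add: lie_group_def)
  then show ?thesis
    using B(3,4) is_atlas_imp_chart_cover regular_map_id[OF B(1)] by blast
qed

lemma mdiff_tau:
  assumes "\<xi> \<in> D"
  shows "mdiff (atlas G) \<tau> \<xi>"
proof -
  obtain B :: "('a, 'e) chart set" where B: "chart_cover B" "regular_map Analytic vec_atlas D B \<tau>"
    "regular_map Smooth B UNIV (atlas G) (\<lambda>x. x)" using analytic_atlas by blast
  have "mdiff vec_atlas (\<lambda>x. x) \<xi>" by (simp add: mdiff_vec_atlas)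
  from mdiff_compose[OF chart_cover_vec_atlas B(2) open_D _ this] assms
  have "mdiff B \<tau> \<xi>" by (simp add: o_def)
  from mdiff_compose[OF B(1) B(3) open_UNIV UNIV_I this] show ?thesis by (simp add: o_def)
qed

lemma differentiable_tau_inv:
  assumes "mdiff (atlas G) F x" "F x \<in> \<tau> ` D"
  shows "(\<lambda>y. inv_into D \<tau> (F y)) differentiable (at x)"
proof -
  obtain B :: "('a, 'e) chart set" where B: "chart_cover B" "regular_map Analytic B (\<tau> ` D) vec_atlas (inv_into D \<tau>)"
    "regular_map Smooth (atlas G) UNIV B (\<lambda>x. x)" using analytic_atlas by blast
  have "mdiff B F x" using mdiff_compose[OF cover B(3) open_UNIV UNIV_I assms(1)] by (simp add: o_def)
  from mdiff_compose[OF B(1,2) open_image assms(2) this] show ?thesis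
    by (simp add: mdiff_vec_atlas o_def)
qed

lemma tangent_rel_mult_right:
  assumes "(c, d) \<in> tangent_rel (atlas G) p"
  shows "(\<lambda>t. gmult G (c t) y, \<lambda>t. gmult G (d t) y) \<in> tangent_rel (atlas G) (gmult G p y)"
proof -
  \<comment> \<open>Right translation is the product with a constant second curve.\<close>
  have "(\<lambda>_. y, \<lambda>_. y) \<in> tangent_rel (atlas G) y"
    by (auto simp: tangent_rel_def curve_at_iff_mdiff mdiff_const)
  from tangent_rel_compose[OF chart_cover_product_atlas[OF cover cover] regular_mult open_UNIV UNIV_I
      tangent_rel_Pair[OF assms this]]
  show ?thesis by (simp add: o_def)
qed

lemma tangent_rel_tau:
  assumes "(c, d) \<in> tangent_rel vec_atlas \<xi>" "\<xi> \<in> D"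
  shows "(\<tau> \<circ> c, \<tau> \<circ> d) \<in> tangent_rel (atlas G) (\<tau> \<xi>)"
proof -
  obtain B :: "('a, 'e) chart set" where B: "chart_cover B" "regular_map Analytic vec_atlas D B \<tau>"
    "regular_map Smooth B UNIV (atlas G) (\<lambda>x. x)" using analytic_atlas by blast
  from tangent_rel_compose[OF B(1,3) open_UNIV UNIV_I
      tangent_rel_compose[OF chart_cover_vec_atlas B(2) open_D assms(2,1)]]
  show ?thesis by (simp add: o_def)
qed

lemma tangent_rel_tau_inv:
  assumes "(c, d) \<in> tangent_rel (atlas G) (\<tau> \<xi>)" "\<xi> \<in> D"
  shows "(inv_into D \<tau> \<circ> c, inv_into D \<tau> \<circ> d) \<in> tangent_rel vec_atlas \<xi>"
proof -
  obtain B :: "('a, 'e) chart set" where B: "chart_cover B" "regular_map Analytic B (\<tau> ` D) vec_atlas (inv_into D \<tau>)"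
    "regular_map Smooth (atlas G) UNIV B (\<lambda>x. x)" using analytic_atlas by blast
  have "(c, d) \<in> tangent_rel B (\<tau> \<xi>)"
    using tangent_rel_compose[OF cover B(3) open_UNIV UNIV_I assms(1)] by (simp add: o_def)
  from tangent_rel_compose[OF B(1,2) open_image _ this] assms(2) show ?thesis by simp
qed

section \<open>The Lie algebra as velocity classes at the unit\<close>

lemma theta_bij: "bij_betw \<theta> UNIV (tangent_space (atlas G) (gunit G))"
  using iso by (simp add: lie_algebra_iso_def)

lemma theta_quotient: "\<theta> \<eta> \<in> {c. curve_at (atlas G) (gunit G) c} // tangent_rel (atlas G) (gunit G)"
  using theta_bij by (auto simp: bij_betw_def tangent_space_def)

lemma theta_curve: "c \<in> \<theta> \<eta> \<Longrightarrow> curve_at (atlas G) (gunit G) c"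
  using in_quotient_imp_subset[OF equiv_tangent_rel theta_quotient] by blast

lemma theta_nonempty: "\<exists>c. c \<in> \<theta> \<eta>"
  using in_quotient_imp_non_empty[OF equiv_tangent_rel theta_quotient] by blast

lemma theta_tangent_rel: "c \<in> \<theta> \<eta> \<Longrightarrow> d \<in> \<theta> \<zeta> \<Longrightarrow> \<eta> = \<zeta> \<longleftrightarrow> (c, d) \<in> tangent_rel (atlas G) (gunit G)"
  using quotient_eq_iff[OF equiv_tangent_rel theta_quotient theta_quotient]
    bij_betw_imp_inj_on[OF theta_bij] by (metis inj_eq)

lemma theta_closed: "c \<in> \<theta> \<eta> \<Longrightarrow> (c, d) \<in> tangent_rel (atlas G) (gunit G) \<Longrightarrow> d \<in> \<theta> \<eta>"
  using in_quotient_imp_closed[OF equiv_tangent_rel theta_quotient] by blast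

lemma theta_unique: "c \<in> \<theta> \<eta> \<Longrightarrow> c \<in> \<theta> \<zeta> \<Longrightarrow> \<eta> = \<zeta>"
  using theta_tangent_rel theta_curve equiv_tangent_rel by (metis (mono_tags) equivE mem_Collect_eq refl_onD)

lemma tangent_vec_theta:
  assumes "c \<in> \<theta> \<eta>"
  shows "tangent_vec (atlas G) c = \<theta> \<eta>"
proof -
  have c: "curve_at (atlas G) (gunit G) c" using assms by (rule theta_curve)
  have "d \<in> \<theta> \<eta> \<longleftrightarrow> (c, d) \<in> tangent_rel (atlas G) (gunit G)" for d
    using assms theta_closed theta_tangent_rel[OF assms, of d \<eta>] by blast
  then show ?thesis using c by (auto simp: tangent_vec_def curve_at_def)
qed

lemma inv_theta_tangent_vec: "c \<in> \<theta> \<eta> \<Longrightarrow> inv \<theta> (tangent_vec (atlas G) c) = \<eta>"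
  using bij_betw_imp_inj_on[OF theta_bij] by (simp add: tangent_vec_theta)

lemma theta_ex:
  assumes c: "curve_at (atlas G) (gunit G) c"
  shows "\<exists>\<eta>. c \<in> \<theta> \<eta>"
proof -
  have "tangent_rel (atlas G) (gunit G) `` {c} \<in> range \<theta>"
    using c theta_bij by (auto simp: bij_betw_def tangent_space_def intro!: quotientI)
  moreover have "c \<in> tangent_rel (atlas G) (gunit G) `` {c}"
    using equiv_class_self[OF equiv_tangent_rel] c by blast
  ultimately show ?thesis by auto
qed

lemma theta_eventually_eq:
  assumes "c \<in> \<theta> \<eta>" "\<forall>\<^sub>F t in nhds 0. d t = c t"
  shows "d \<in> \<theta> \<eta>"
  using theta_closed[OF assms(1) tangent_rel_eventually_eq[OF theta_curve[OF assms(1)] assms(2)]] .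

text \<open>The linear map \<open>L\<close> comes with \<open>lie_algebra_iso\<close>; its
  bijectivity has to be proved. It is injective because the velocity in one chart determines the
  class and \<open>\<theta>\<close> is injective, and surjective because every chart velocity is
  that of some curve through the unit. This identifies the Lie algebra with the model space.\<close>

lemma unit_chart:
  obtains U \<phi> L where "(U, \<phi>) \<in> atlas G" "gunit G \<in> U" "linear (L :: 'g \<Rightarrow> 'e)" "bij L"
    "\<And>\<eta> c. c \<in> \<theta> \<eta> \<Longrightarrow> ((\<phi> \<circ> c) has_vector_derivative L \<eta>) (at 0)"
proof -
  obtain U \<phi> where U: "(U, \<phi>) \<in> atlas G" "gunit G \<in> U" "open U" "inj_on \<phi> U"
    using chart_cover_obtain[OF cover] .
  obtain L where L: "linear L"
    "\<And>\<eta> c. c \<in> \<theta> \<eta> \<Longrightarrow> ((\<phi> \<circ> c) has_vector_derivative L \<eta>) (at 0)"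
    using iso U(1,2) by (fastforce simp: lie_algebra_iso_def)
  have vd: "c \<in> \<theta> \<eta> \<Longrightarrow> vector_derivative (\<phi> \<circ> c) (at 0) = L \<eta>" for c \<eta>
    using L(2) vector_derivative_at by blast
  have "inj L"
  proof (rule injI)
    fix \<eta> \<zeta> assume eq: "L \<eta> = L \<zeta>"
    obtain c d where c: "c \<in> \<theta> \<eta>" and d: "d \<in> \<theta> \<zeta>" using theta_nonempty by blast
    have "(c, d) \<in> tangent_rel (atlas G) (gunit G)"
      using tangent_rel_chart[OF atlas U(1,2) theta_curve[OF c] theta_curve[OF d]] vd[OF c] vd[OF d] eq
      by simp
    then show "\<eta> = \<zeta>" using theta_tangent_rel[OF c d] by simp
  qed
  moreover have "surj L"
  proof (rule surjI[of _ "\<lambda>v. SOME \<eta>. L \<eta> = v"])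
    fix v
    \<comment> \<open>The curve with prescribed chart velocity \<open>v\<close> is a straight line
      in the chart, pulled back to the group. The two agree only near 0, where the line stays in the
      image of the chart.\<close>
    define q where "q t = \<phi> (gunit G) + t *\<^sub>R v" for t :: real
    define c where "c = inv_into U \<phi> \<circ> q"
    have "is_chart (U, \<phi>)" using atlas U(1) by (auto simp: is_atlas_def)
    then have o: "open (\<phi> ` U)" and hm: "homeomorphism U (\<phi> ` U) \<phi> (inv_into U \<phi>)"
      by (auto simp: is_chart_def)
    have q: "(q has_vector_derivative v) (at 0)" unfolding q_def by (rule has_vector_derivative_line)
    then have cq: "isCont q 0" by (rule has_vector_derivative_continuous)
    have q0: "q 0 \<in> \<phi> ` U" using U(2) by (simp add: q_def)
    have "isCont (inv_into U \<phi>) (q 0)"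
      using homeomorphism_cont2[OF hm] continuous_on_eq_continuous_at[OF o] q0 by blast
    then have cc: "isCont c 0" unfolding c_def using cq by (intro continuous_at_compose)
    have c0: "c 0 = gunit G" using U by (simp add: c_def q_def)
    have "\<forall>\<^sub>F t in nhds 0. q t \<in> \<phi> ` U" using eventually_in_open[OF cq o q0] .
    then have ev: "\<forall>\<^sub>F t in at 0. q t = (\<phi> \<circ> c) t"
      unfolding eventually_at_filter by eventually_elim (simp add: c_def f_inv_into_f)
    have pd: "((\<phi> \<circ> c) has_vector_derivative v) (at 0)"
      unfolding has_vector_derivative_def
      by (rule has_derivative_transform_eventually[OF q[unfolded has_vector_derivative_def] ev])
        (simp_all add: c0, simp add: q_def)
    have "(\<phi> \<circ> c) differentiable (at 0)" using pd by (rule differentiableI_vector)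
    then have "mdiff (atlas G) c 0" using mdiff_chart[OF atlas U(1) _ cc] U(2) c0 by simp
    then obtain \<eta> where "c \<in> \<theta> \<eta>" using theta_ex c0 by (auto simp: curve_at_iff_mdiff)
    then have "L \<eta> = v" using vd pd vector_derivative_at by metis
    then show "L (SOME \<eta>. L \<eta> = v) = v" by (rule someI)
  qed
  ultimately show thesis using that[OF U(1,2) L(1) _ L(2)] by (simp add: bij_def)
qed

text \<open>\<open>lie_group\<close> gives a finite spanning set of the model space;
  \<open>L\<close> carries it back to the Lie algebra.\<close>

lemma finite_dim: obtains S :: "'g set" where "finite S" "span S = UNIV"
proof -
  obtain L :: "'g \<Rightarrow> 'e" where L: "linear L" "bij L" using unit_chart by metis
  obtain B :: "'e set" where B: "finite B" "span B = UNIV" using lie by (auto simp: lie_group_def)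
  define S where "S = inv L ` B"
  have LS: "L ` S = B" using L(2) by (simp add: S_def image_f_inv_f bij_is_surj)
  have "x \<in> span S" for x
  proof -
    have "L x \<in> L ` span S" using linear_span_image[OF L(1), of S] LS B by simp
    then show ?thesis using L(2) by (auto dest: bij_is_inj injD)
  qed
  then show thesis using that[of S] B by (auto simp: S_def)
qed

lemma linear_bounded_g: "linear f \<Longrightarrow> bounded_linear f" for f :: "'g \<Rightarrow> 'b::real_normed_vector"
  using finite_dim linear_imp_bounded_linear_finite_dim by metis

lemma blinfun_separates_points: "(\<And>m :: 'g \<Rightarrow>\<^sub>L real. blinfun_apply m x = 0) \<Longrightarrow> x = 0"
  using finite_dim blinfun_separates_points_finite_dim by metis

text \<open>In a chart at the unit the velocity of \<open>F \<circ> p\<close> is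
  \<open>F' v\<close>, and \<open>M\<close> is this value pulled back by \<open>L\<close>. The point
  is that one linear \<open>M\<close> serves all curves \<open>p\<close>, straight or not.\<close>

lemma mdiff_velocity:
  fixes F :: "'v::real_normed_vector \<Rightarrow> 'a"
  assumes F: "mdiff (atlas G) F x" and Fx: "F x = gunit G"
  obtains M where "linear M"
    "\<And>p v. p 0 = x \<Longrightarrow> (p has_vector_derivative v) (at 0) \<Longrightarrow> F \<circ> p \<in> \<theta> (M v)"
proof -
  obtain U \<phi> L where U: "(U, \<phi>) \<in> atlas G" "gunit G \<in> U" and L: "linear L" "bij L"
    "\<And>\<eta> c. c \<in> \<theta> \<eta> \<Longrightarrow> ((\<phi> \<circ> c) has_vector_derivative L \<eta>) (at 0)"
    using unit_chart by metis
  obtain F' where F': "((\<phi> \<circ> F) has_derivative F') (at x)"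
    using F U Fx by (auto simp: mdiff_def differentiable_def)
  have linF': "linear F'" using F' has_derivative_bounded_linear bounded_linear.linear by blast
  define M where "M v = inv L (F' v)" for v
  have LM: "L (M v) = F' v" for v using L(2) by (simp add: M_def surj_f_inv_f bij_is_surj)
  have "linear M"
    by (rule linearI; rule injD[OF bij_is_inj[OF L(2)]])
      (simp_all add: LM linear_add[OF L(1)] linear_cmul[OF L(1)] linear_add[OF linF'] linear_cmul[OF linF'])
  moreover have "F \<circ> p \<in> \<theta> (M v)" if p: "p 0 = x" "(p has_vector_derivative v) (at 0)" for p v
  proof -
    have "mdiff (atlas G) (F \<circ> p) 0"
      using mdiff_compose_vec[of _ F p 0] F p differentiableI_vector by blast
    then have "curve_at (atlas G) (gunit G) (F \<circ> p)" using p Fx by (simp add: curve_at_iff_mdiff)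
    then obtain \<eta> where \<eta>: "F \<circ> p \<in> \<theta> \<eta>" using theta_ex by blast
    have "((\<phi> \<circ> (F \<circ> p)) has_vector_derivative F' v) (at 0)"
      using vector_derivative_diff_chain_within[of p v 0 UNIV "\<phi> \<circ> F" F'] p
        has_derivative_at_withinI[OF F'] by (simp add: o_assoc)
    then have "L \<eta> = F' v" using L(3)[OF \<eta>] vector_derivative_at by metis
    then show ?thesis using \<eta> LM bij_is_inj[OF L(2)] by (metis injD)
  qed
  ultimately show thesis using that by blast
qed

section \<open>Linearity and invertibility of the right-trivialised differential\<close>

lemma mdiff_tau_mult: "\<xi> \<in> D \<Longrightarrow> mdiff (atlas G) (\<lambda>x. gmult G (\<tau> x) y) \<xi>"
  by (intro mdiff_mult mdiff_tau mdiff_const)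

text \<open>The two nested tangent maps collapse to the class of one explicit curve through the
  unit.\<close>

lemma dtau_eq:
  assumes \<xi>: "\<xi> \<in> D"
  shows "dtau G \<theta> \<tau> \<xi> \<eta> = inv \<theta> (tangent_vec (atlas G) (\<lambda>t. gmult G (\<tau> (\<xi> + t *\<^sub>R \<eta>)) (ginv G (\<tau> \<xi>))))"
proof -
  define p where "p t = \<xi> + t *\<^sub>R \<eta>" for t :: real
  have p: "p differentiable (at 0)" unfolding p_def
    using has_vector_derivative_line differentiableI_vector by blast
  have "curve_at vec_atlas \<xi> p" using p by (simp add: curve_at_iff_mdiff mdiff_vec_atlas p_def)
  then have 1: "tangent_map (atlas G) \<tau> (tangent_vec vec_atlas p) = tangent_vec (atlas G) (\<tau> \<circ> p)"
    using tangent_rel_tau \<xi> by (intro tangent_map_tangent_vec) auto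
  have "curve_at (atlas G) (\<tau> \<xi>) (\<tau> \<circ> p)"
    using mdiff_compose_vec[of _ \<tau> p 0] mdiff_tau[OF \<xi>] p by (simp add: curve_at_iff_mdiff p_def)
  then have "tangent_map (atlas G) (\<lambda>x. gmult G x (ginv G (\<tau> \<xi>))) (tangent_vec (atlas G) (\<tau> \<circ> p))
      = tangent_vec (atlas G) ((\<lambda>x. gmult G x (ginv G (\<tau> \<xi>))) \<circ> (\<tau> \<circ> p))"
    using tangent_rel_mult_right by (intro tangent_map_tangent_vec) (auto simp: o_def)
  with 1 show ?thesis unfolding dtau_def p_def by (simp add: o_def)
qed

text \<open>The definition of \<open>dtau\<close> sees only straight lines through
  \<open>\<xi>\<close>. The linear map from \<open>mdiff_velocity\<close> agrees with it on lines
  and therefore describes the velocity along every differentiable \<open>p\<close>;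
  \<open>lift_curve\<close> needs it for a curve that is not straight.\<close>

lemma linear_dtau: "\<xi> \<in> D \<Longrightarrow> linear (dtau G \<theta> \<tau> \<xi>)"
  and dtau_velocity: "\<xi> \<in> D \<Longrightarrow> p 0 = \<xi> \<Longrightarrow> (p has_vector_derivative v) (at 0) \<Longrightarrow>
    (\<lambda>t. gmult G (\<tau> (p t)) (ginv G (\<tau> \<xi>))) \<in> \<theta> (dtau G \<theta> \<tau> \<xi> v)"
proof -
  assume \<xi>: "\<xi> \<in> D"
  obtain M where M: "linear M" "\<And>p v. p 0 = \<xi> \<Longrightarrow> (p has_vector_derivative v) (at 0) \<Longrightarrow>
      (\<lambda>x. gmult G (\<tau> x) (ginv G (\<tau> \<xi>))) \<circ> p \<in> \<theta> (M v)"
    using mdiff_velocity[OF mdiff_tau_mult[OF \<xi>, of "ginv G (\<tau> \<xi>)"]] right_inverse by metis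
  have eq: "dtau G \<theta> \<tau> \<xi> = M"
  proof
    fix \<eta>
    have "(\<lambda>x. gmult G (\<tau> x) (ginv G (\<tau> \<xi>))) \<circ> (\<lambda>t. \<xi> + t *\<^sub>R \<eta>) \<in> \<theta> (M \<eta>)"
      using has_vector_derivative_line by (intro M(2)) auto
    then show "dtau G \<theta> \<tau> \<xi> \<eta> = M \<eta>"
      unfolding dtau_eq[OF \<xi>] by (intro inv_theta_tangent_vec) (simp add: o_def)
  qed
  show "linear (dtau G \<theta> \<tau> \<xi>)" using M eq by simp
  show "(\<lambda>t. gmult G (\<tau> (p t)) (ginv G (\<tau> \<xi>))) \<in> \<theta> (dtau G \<theta> \<tau> \<xi> v)"
    if "p 0 = \<xi>" "(p has_vector_derivative v) (at 0)"
    using M(2)[OF that] eq by (simp add: o_def)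
qed

text \<open>A curve \<open>c\<close> through the unit lifts to the curve \<open>\<tau>\<^sup>-\<^sup>1(c \<tau>(\<xi>))\<close> through \<open>\<xi>\<close>; this inverts
  the differential at \<open>\<xi>\<close>.\<close>

lemma lift_curve:
  assumes \<xi>: "\<xi> \<in> D" and c: "c \<in> \<theta> \<eta>"
  obtains z where "((\<lambda>t. inv_into D \<tau> (gmult G (c t) (\<tau> \<xi>))) has_vector_derivative z) (at 0)"
    "dtau G \<theta> \<tau> \<xi> z = \<eta>"
proof -
  define q where "q t = inv_into D \<tau> (gmult G (c t) (\<tau> \<xi>))" for t
  have cu: "curve_at (atlas G) (gunit G) c" using c by (rule theta_curve)
  have m: "mdiff (atlas G) (\<lambda>t. gmult G (c t) (\<tau> \<xi>)) 0"
    using cu by (intro mdiff_mult mdiff_const) (simp add: curve_at_iff_mdiff)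
  have at0: "gmult G (c 0) (\<tau> \<xi>) = \<tau> \<xi>" using cu by (simp add: curve_at_def group_left_neutral)
  have "q differentiable (at 0)"
    unfolding q_def using \<xi> at0 by (intro differentiable_tau_inv m) simp
  then obtain z where z: "(q has_vector_derivative z) (at 0)"
    using vector_derivative_works by blast
  have "q 0 = \<xi>" using at0 \<xi> by (simp add: q_def)
  then have "(\<lambda>t. gmult G (\<tau> (q t)) (ginv G (\<tau> \<xi>))) \<in> \<theta> (dtau G \<theta> \<tau> \<xi> z)"
    using dtau_velocity[OF \<xi> _ z] by simp
  moreover have "\<forall>\<^sub>F t in nhds 0. c t = gmult G (\<tau> (q t)) (ginv G (\<tau> \<xi>))"
  proof -
    have "\<forall>\<^sub>F t in nhds 0. gmult G (c t) (\<tau> \<xi>) \<in> \<tau> ` D"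
      using m \<xi> at0 by (intro eventually_in_open open_image) (auto simp: mdiff_def)
    then show ?thesis
      by eventually_elim (simp add: q_def f_inv_into_f assoc)
  qed
  ultimately have "c \<in> \<theta> (dtau G \<theta> \<tau> \<xi> z)" by (rule theta_eventually_eq)
  then have "dtau G \<theta> \<tau> \<xi> z = \<eta>" using c theta_unique by blast
  with z that show thesis unfolding q_def by blast
qed

text \<open>For injectivity, equal values give tangent curves through the unit; translating by
  \<open>\<tau> \<xi>\<close> and applying the inverse of \<open>\<tau>\<close> recovers the lines
  in directions \<open>v\<close> and \<open>w\<close>, whose velocities must agree. Surjectivity is
  the lifting of curves.\<close>

lemma bij_dtau:
  assumes \<xi>: "\<xi> \<in> D"
  shows "bij (dtau G \<theta> \<tau> \<xi>)"
proof (rule bijI)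
  show "inj (dtau G \<theta> \<tau> \<xi>)"
  proof (rule injI)
    fix v w assume eq: "dtau G \<theta> \<tau> \<xi> v = dtau G \<theta> \<tau> \<xi> w"
    define P where "P v t = \<xi> + t *\<^sub>R v" for v and t :: real
    define C where "C v t = gmult G (\<tau> (P v t)) (ginv G (\<tau> \<xi>))" for v t
    have P: "(P v has_vector_derivative v) (at 0)" "P v 0 = \<xi>" for v
      unfolding P_def by (rule has_vector_derivative_line) simp
    have C: "C v \<in> \<theta> (dtau G \<theta> \<tau> \<xi> v)" for v
      unfolding C_def using dtau_velocity[OF \<xi> P(2,1)] .
    have "(C v, C w) \<in> tangent_rel (atlas G) (gunit G)"
      using theta_tangent_rel[OF C C] eq by blast
    from tangent_rel_mult_right[OF this, of "\<tau> \<xi>"]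
    have "(\<lambda>t. \<tau> (P v t), \<lambda>t. \<tau> (P w t)) \<in> tangent_rel (atlas G) (\<tau> \<xi>)"
      by (simp add: C_def assoc group_left_neutral)
    from tangent_rel_tau_inv[OF this \<xi>]
    have "vector_derivative (\<lambda>t. inv_into D \<tau> (\<tau> (P v t))) (at 0)
        = vector_derivative (\<lambda>t. inv_into D \<tau> (\<tau> (P w t))) (at 0)"
      by (simp add: tangent_rel_vec_atlas o_def)
    \<comment> \<open>The inverse undoes \<open>\<tau>\<close> only on \<open>D\<close>, so the line
      is recovered only for small \<open>t\<close>, which suffices for the derivative.\<close>
    moreover have "vector_derivative (\<lambda>t. inv_into D \<tau> (\<tau> (P u t))) (at 0) = u" for u
    proof -
      have "\<forall>\<^sub>F t in nhds 0. P u t \<in> D"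
        using P \<xi> by (intro eventually_in_open open_D has_vector_derivative_continuous) auto
      then have "vector_derivative (\<lambda>t. inv_into D \<tau> (\<tau> (P u t))) (at 0) = vector_derivative (P u) (at 0)"
        by (intro vector_derivative_cong_eq) (auto elim: eventually_mono)
      then show ?thesis using P vector_derivative_at by metis
    qed
    ultimately show "v = w" by simp
  qed
  show "surj (dtau G \<theta> \<tau> \<xi>)"
    using theta_nonempty lift_curve[OF \<xi>] by (metis surj_def)
qed

lemma dtau_inv_dtau [simp]: "\<xi> \<in> D \<Longrightarrow> dtau_inv G \<theta> \<tau> \<xi> (dtau G \<theta> \<tau> \<xi> v) = v"
  unfolding dtau_inv_def using bij_dtau by (simp add: bij_is_inj)

lemma dtau_dtau_inv [simp]: "\<xi> \<in> D \<Longrightarrow> dtau G \<theta> \<tau> \<xi> (dtau_inv G \<theta> \<tau> \<xi> v) = v"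
  unfolding dtau_inv_def using bij_dtau by (simp add: bij_is_surj surj_f_inv_f)

lemma linear_dtau_inv:
  assumes \<xi>: "\<xi> \<in> D"
  shows "linear (dtau_inv G \<theta> \<tau> \<xi>)"
  by (rule linearI; rule injD[OF bij_is_inj[OF bij_dtau[OF \<xi>]]])
    (simp_all add: \<xi> linear_add[OF linear_dtau[OF \<xi>]] linear_cmul[OF linear_dtau[OF \<xi>]])

lemma dual_map_apply:
  fixes f :: "'g \<Rightarrow> 'g"
  assumes "linear f"
  shows "blinfun_apply (dual_map f m) v = blinfun_apply m (f v)"
proof -
  have "bounded_linear (\<lambda>v. blinfun_apply m (f v))"
    using linear_bounded_g[OF assms] by (intro bounded_linear_compose[OF blinfun.bounded_linear_right])
  then show ?thesis by (simp add: dual_map_def bounded_linear_Blinfun_apply)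
qed

text \<open>Since \<open>\<tau>(- x) = \<tau>(x)\<^sup>-\<^sup>1\<close>, the curve \<open>\<tau>(\<xi> + t v)\<^sup>-\<^sup>1 \<tau>(\<xi>)\<close> through the unit is
  \<open>\<tau>(- \<xi> - t v) \<tau>(- \<xi>)\<^sup>-\<^sup>1\<close>, whose velocity is minus \<open>d\<tau>\<close> at \<open>- \<xi>\<close> applied to \<open>v\<close>.\<close>

lemma tau_inv_shift_derivative:
  assumes \<xi>: "\<xi> \<in> D" "- \<xi> \<in> D" and \<zeta>: "\<zeta> \<in> D"
  shows "((\<lambda>t. inv_into D \<tau> (gmult G (ginv G (\<tau> (\<xi> + t *\<^sub>R v))) (gmult G (\<tau> \<xi>) (\<tau> \<zeta>))))
    has_vector_derivative - dtau_inv G \<theta> \<tau> \<zeta> (dtau G \<theta> \<tau> (- \<xi>) v)) (at 0)"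
proof -
  define c where "c t = gmult G (ginv G (\<tau> (\<xi> + t *\<^sub>R v))) (\<tau> \<xi>)" for t :: real
  have "(\<lambda>t. gmult G (\<tau> (- \<xi> + t *\<^sub>R - v)) (ginv G (\<tau> (- \<xi>)))) \<in> \<theta> (dtau G \<theta> \<tau> (- \<xi>) (- v))"
    by (intro dtau_velocity[OF \<xi>(2)] has_vector_derivative_line) simp
  moreover have "\<forall>\<^sub>F t in nhds 0. c t = gmult G (\<tau> (- \<xi> + t *\<^sub>R - v)) (ginv G (\<tau> (- \<xi>)))"
  proof -
    have "\<forall>\<^sub>F t in nhds 0. \<xi> + t *\<^sub>R v \<in> D" "\<forall>\<^sub>F t in nhds 0. - (\<xi> + t *\<^sub>R v) \<in> D"
      using \<xi> by (intro eventually_in_open open_D continuous_intros; simp)+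
    then show ?thesis
      by eventually_elim (simp add: c_def tau_uminus[of "- \<xi>"] tau_uminus[symmetric] \<xi>)
  qed
  ultimately have "c \<in> \<theta> (dtau G \<theta> \<tau> (- \<xi>) (- v))" by (rule theta_eventually_eq)
  then obtain z where z: "((\<lambda>t. inv_into D \<tau> (gmult G (c t) (\<tau> \<zeta>))) has_vector_derivative z) (at 0)"
    and "dtau G \<theta> \<tau> \<zeta> z = dtau G \<theta> \<tau> (- \<xi>) (- v)" using lift_curve[OF \<zeta>] by metis
  then have "z = dtau_inv G \<theta> \<tau> \<zeta> (dtau G \<theta> \<tau> (- \<xi>) (- v))" using \<zeta> dtau_inv_dtau by metis
  also have "\<dots> = - dtau_inv G \<theta> \<tau> \<zeta> (dtau G \<theta> \<tau> (- \<xi>) v)"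
    by (simp add: linear_neg[OF linear_dtau[OF \<xi>(2)]] linear_neg[OF linear_dtau_inv[OF \<zeta>]])
  finally show ?thesis using z by (simp add: c_def assoc)
qed

end

section \<open>The first variation of the discrete action\<close>

lemma pairing_deriv:
  fixes f :: "real \<Rightarrow> 'v::real_normed_vector"
  assumes f: "(f has_vector_derivative f') (at 0)"
  shows "((\<lambda>t. blinfun_apply (m + t *\<^sub>R dm) (f t)) has_real_derivative
    blinfun_apply dm (f 0) + blinfun_apply m f') (at 0)"
proof -
  have "((\<lambda>t. blinfun_apply n (f t)) has_real_derivative blinfun_apply n f') (at 0)" for n :: "'v \<Rightarrow>\<^sub>L real"
    using bounded_linear.has_vector_derivative[OF blinfun.bounded_linear_right f]
    by (simp add: has_real_derivative_iff_has_vector_derivative)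
  from DERIV_add[OF this[of m] DERIV_mult[OF DERIV_ident this[of dm]]]
  show ?thesis by (simp add: blinfun.add_left blinfun.scaleR_left algebra_simps)
qed

lemma constraint_deriv:
  fixes T :: "real \<Rightarrow> 'v::real_normed_vector"
  assumes "(T has_vector_derivative T') (at 0)"
  shows "((\<lambda>t. (1 / h) *\<^sub>R T t - (\<Sum>j\<in>J. w j *\<^sub>R (X j + t *\<^sub>R dX j))) has_vector_derivative
    (1 / h) *\<^sub>R T' - (\<Sum>j\<in>J. w j *\<^sub>R dX j)) (at 0)"
  by (intro has_vector_derivative_diff has_vector_derivative_sum has_vector_derivative_line
      bounded_linear.has_vector_derivative[OF bounded_linear_scaleR_right] assms)

lemma dl_apply:
  fixes l :: "'g::real_normed_vector \<times> 'g \<Rightarrow> real"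
  assumes "l differentiable (at (x, u))"
  shows "frechet_derivative l (at (x, u)) (v, w)
    = blinfun_apply (dl_dxi l x u) v + blinfun_apply (dl_du l x u) w"
proof -
  define l' where "l' = frechet_derivative l (at (x, u))"
  have l': "(l has_derivative l') (at (x, u))"
    using assms frechet_derivative_works unfolding l'_def by blast
  have lin: "bounded_linear l'" using l' by (rule has_derivative_bounded_linear)
  have "((\<lambda>y. l (y, u)) has_derivative (\<lambda>v. l' (v, 0))) (at x)"
    by (rule has_derivative_compose[of "\<lambda>y. (y, u)" _ _ _ l l', simplified])
      (auto intro!: derivative_eq_intros l')
  then have 1: "blinfun_apply (dl_dxi l x u) v = l' (v, 0)"
    by (simp add: dl_dxi_def frechet_derivative_at[symmetric] bounded_linear_Blinfun_apply
        has_derivative_bounded_linear)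
  have "((\<lambda>y. l (x, y)) has_derivative (\<lambda>v. l' (0, v))) (at u)"
    by (rule has_derivative_compose[of "\<lambda>y. (x, y)" _ _ _ l l', simplified])
      (auto intro!: derivative_eq_intros l')
  then have 2: "blinfun_apply (dl_du l x u) w = l' (0, w)"
    by (simp add: dl_du_def frechet_derivative_at[symmetric] bounded_linear_Blinfun_apply
        has_derivative_bounded_linear)
  show ?thesis
    using linear_add[OF bounded_linear.linear[OF lin], of "(v, 0)" "(0, w)"] 1 2 by (simp add: l'_def)
qed

lemma lagrangian_deriv:
  fixes l :: "'g::real_normed_vector \<times> 'g \<Rightarrow> real"
  assumes "l differentiable (at (x, u))"
  shows "((\<lambda>t. l (x + t *\<^sub>R v, u + t *\<^sub>R w)) has_real_derivative
    blinfun_apply (dl_dxi l x u) v + blinfun_apply (dl_du l x u) w) (at 0)"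
proof -
  have p: "((\<lambda>t. (x + t *\<^sub>R v, u + t *\<^sub>R w)) has_vector_derivative (v, w)) (at 0)"
    by (intro has_vector_derivative_Pair has_vector_derivative_line)
  have "(l has_derivative frechet_derivative l (at (x, u))) (at (x + 0 *\<^sub>R v, u + 0 *\<^sub>R w) within range (\<lambda>t. (x + t *\<^sub>R v, u + t *\<^sub>R w)))"
    using assms frechet_derivative_works by (auto intro: has_derivative_at_withinI)
  from vector_derivative_diff_chain_within[OF p this]
  show ?thesis by (simp add: o_def dl_apply[OF assms] has_real_derivative_iff_has_vector_derivative)
qed

lemma sum_eq_single:
  assumes "finite S" "k \<in> S" "\<And>j. j \<in> S \<Longrightarrow> j \<noteq> k \<Longrightarrow> f j = 0"
  shows "sum f S = (f k :: 'b::comm_monoid_add)"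
  using assms by (simp add: sum.remove[of S k] sum.neutral)

text \<open>An interior node enters exactly two consecutive summands of the action, as the end of
  one step and the start of the next.\<close>

lemma sum_eq_pair:
  assumes "Suc k < N" "\<And>j. j < N \<Longrightarrow> j \<noteq> k \<Longrightarrow> j \<noteq> Suc k \<Longrightarrow> f j = 0"
  shows "(\<Sum>j<N. f j) = (f k + f (Suc k) :: 'b::comm_monoid_add)"
proof -
  have "(\<Sum>j<N. f j) = (\<Sum>j\<in>{k, Suc k}. f j)"
    using assms by (intro sum.mono_neutral_right) auto
  then show ?thesis by simp
qed

locale hohp_solution = lie_exp_approx G \<theta> D \<tau>
  for G :: "('a::{t2_space, second_countable_topology}, 'e::real_normed_vector) lie_data"
    and \<theta> :: "'g::real_normed_vector \<Rightarrow> (real \<Rightarrow> 'a) set"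
    and D :: "'g set" and \<tau> :: "'g \<Rightarrow> 'a" +
  fixes l :: "'g \<times> 'g \<Rightarrow> real"
    and h :: real and N s :: nat
    and a :: "nat \<Rightarrow> nat \<Rightarrow> real" and b :: "nat \<Rightarrow> real"
    and \<gamma> :: "('a, 'g) path"
  assumes smooth_l: "smooth_map_on UNIV l" and h_pos: "h > 0"
    and b_nonzero: "i \<in> {1..s} \<Longrightarrow> b i \<noteq> 0"
    and domain: "arguments_in_domain G D \<tau> h N s a b \<gamma>"
    and solution: "discrete_HOHP_solution G D \<tau> l h N s a b \<gamma>"
begin

abbreviation stage_arg where "stage_arg k i \<equiv> gmult G (ginv G (g \<gamma> k)) (Gs \<gamma> k i)"
abbreviation node_arg where "node_arg k \<equiv> gmult G (ginv G (g \<gamma> k)) (g \<gamma> (k + 1))"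

text \<open>This is the derivative of the action divided by \<open>h\<close>. The derivatives
  \<open>dT\<close> and \<open>dU\<close> of the stage and node terms in
  \<open>\<tau>\<^sup>-\<^sup>1\<close> are free parameters rather than expressions in the
  variations of the group variables; each application supplies them together with its
  curves.\<close>

definition action_variation where
  "action_variation dT dU dxi dcmu dnu dXi dV dmu dnus =
    (\<Sum>k<N.
      (\<Sum>i=1..s. b i * (blinfun_apply (dl_dxi l (Xis \<gamma> k i) (Vs \<gamma> k i)) (dXi k i)
                      + blinfun_apply (dl_du l (Xis \<gamma> k i) (Vs \<gamma> k i)) (dV k i))
        + (blinfun_apply (dmu k i) ((1 / h) *\<^sub>R inv_into D \<tau> (stage_arg k i) - (\<Sum>j=1..s. a i j *\<^sub>R Xis \<gamma> k j))
          + blinfun_apply (mus \<gamma> k i) ((1 / h) *\<^sub>R dT k i - (\<Sum>j=1..s. a i j *\<^sub>R dXi k j)))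
        + (blinfun_apply (dnus k i) ((1 / h) *\<^sub>R (Xis \<gamma> k i - xi \<gamma> k) - (\<Sum>j=1..s. a i j *\<^sub>R Vs \<gamma> k j))
          + blinfun_apply (nus \<gamma> k i) ((1 / h) *\<^sub>R (dXi k i - dxi k) - (\<Sum>j=1..s. a i j *\<^sub>R dV k j))))
      + (blinfun_apply (dcmu (k + 1)) ((1 / h) *\<^sub>R inv_into D \<tau> (node_arg k) - (\<Sum>i=1..s. b i *\<^sub>R Xis \<gamma> k i))
        + blinfun_apply (cmu \<gamma> (k + 1)) ((1 / h) *\<^sub>R dU k - (\<Sum>i=1..s. b i *\<^sub>R dXi k i)))
      + (blinfun_apply (dnu (k + 1)) ((1 / h) *\<^sub>R (xi \<gamma> (k + 1) - xi \<gamma> k) - (\<Sum>i=1..s. b i *\<^sub>R Vs \<gamma> k i))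
        + blinfun_apply (nu \<gamma> (k + 1)) ((1 / h) *\<^sub>R (dxi (k + 1) - dxi k) - (\<Sum>i=1..s. b i *\<^sub>R dV k i))))"

text \<open>Vector and multiplier variables move along straight lines, group variables along
  prescribed curves. Keeping the end nodes constant is a special case of zero end velocity, and such
  curves already produce all the equations.\<close>

lemma first_variation:
  assumes gc: "\<And>k. curve_at (atlas G) (g \<gamma> k) (gc k)"
    and ends: "gc 0 = (\<lambda>t. g \<gamma> 0)" "gc N = (\<lambda>t. g \<gamma> N)" "dxi 0 = 0" "dxi N = 0"
    and Gc: "\<And>k i. curve_at (atlas G) (Gs \<gamma> k i) (Gc k i)"
    and dT: "\<And>k i. k < N \<Longrightarrow> i \<in> {1..s} \<Longrightarrow>
      ((\<lambda>t. inv_into D \<tau> (gmult G (ginv G (gc k t)) (Gc k i t))) has_vector_derivative dT k i) (at 0)"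
    and dU: "\<And>k. k < N \<Longrightarrow>
      ((\<lambda>t. inv_into D \<tau> (gmult G (ginv G (gc k t)) (gc (k + 1) t))) has_vector_derivative dU k) (at 0)"
  shows "action_variation dT dU dxi dcmu dnu dXi dV dmu dnus = 0"
    (is "?S = 0")
proof -
  define \<Gamma> :: "real \<Rightarrow> ('a, 'g) path" where "\<Gamma> t = \<lparr>
    g = (\<lambda>k. gc k t), xi = (\<lambda>k. xi \<gamma> k + t *\<^sub>R dxi k),
    cmu = (\<lambda>k. cmu \<gamma> k + t *\<^sub>R dcmu k), nu = (\<lambda>k. nu \<gamma> k + t *\<^sub>R dnu k),
    Gs = (\<lambda>k i. Gc k i t), Xis = (\<lambda>k i. Xis \<gamma> k i + t *\<^sub>R dXi k i),
    Vs = (\<lambda>k i. Vs \<gamma> k i + t *\<^sub>R dV k i),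
    mus = (\<lambda>k i. mus \<gamma> k i + t *\<^sub>R dmu k i), nus = (\<lambda>k i. nus \<gamma> k i + t *\<^sub>R dnus k i)\<rparr>" for t
  note sel = \<Gamma>_def path.simps
  have gc0: "gc k 0 = g \<gamma> k" and Gc0: "Gc k i 0 = Gs \<gamma> k i" for k i
    using gc Gc by (auto simp: curve_at_def)
  have line: "(\<lambda>t. x + t *\<^sub>R v) differentiable (at 0)" for x v :: "'x::real_normed_vector"
    using has_vector_derivative_line differentiableI_vector by blast
  have "\<Gamma> 0 = \<gamma>" by (simp add: \<Gamma>_def gc0 Gc0)
  then have "path_curve G N s \<gamma> \<Gamma>" using gc Gc by (simp add: path_curve_def sel line)
  moreover have "fixed_ends G N \<gamma> \<Gamma>" using ends by (simp add: fixed_ends_def sel)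
  ultimately have 0: "((\<lambda>t. action G D \<tau> l h N s a b (\<Gamma> t)) has_real_derivative 0) (at 0)"
    using solution by (simp add: discrete_HOHP_solution_def)
  have dl: "l differentiable (at p)" for p using smooth_map_on_differentiable[OF smooth_l] by simp
  \<comment> \<open>A difference of two lines is again a line, so the linear constraints become
    instances of \<open>constraint_deriv\<close>.\<close>
  have dist: "x + t *\<^sub>R v - (y + t *\<^sub>R w) = (x - y) + t *\<^sub>R (v - w)" for x v y w :: 'g and t
    by (simp add: algebra_simps)
  have mu: "((\<lambda>t. blinfun_apply (mus \<gamma> k i + t *\<^sub>R dmu k i)
      ((1 / h) *\<^sub>R inv_into D \<tau> (gmult G (ginv G (gc k t)) (Gc k i t))
       - (\<Sum>j=1..s. a i j *\<^sub>R (Xis \<gamma> k j + t *\<^sub>R dXi k j)))) has_real_derivative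
      blinfun_apply (dmu k i) ((1 / h) *\<^sub>R inv_into D \<tau> (stage_arg k i) - (\<Sum>j=1..s. a i j *\<^sub>R Xis \<gamma> k j))
      + blinfun_apply (mus \<gamma> k i) ((1 / h) *\<^sub>R dT k i - (\<Sum>j=1..s. a i j *\<^sub>R dXi k j))) (at 0)"
    if "k < N" "i \<in> {1..s}" for k i
    using pairing_deriv[OF constraint_deriv[OF dT[OF that]]] by (simp add: gc0 Gc0)
  have cm: "((\<lambda>t. blinfun_apply (cmu \<gamma> (k + 1) + t *\<^sub>R dcmu (k + 1))
      ((1 / h) *\<^sub>R inv_into D \<tau> (gmult G (ginv G (gc k t)) (gc (k + 1) t))
       - (\<Sum>j=1..s. b j *\<^sub>R (Xis \<gamma> k j + t *\<^sub>R dXi k j)))) has_real_derivative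
      blinfun_apply (dcmu (k + 1)) ((1 / h) *\<^sub>R inv_into D \<tau> (node_arg k) - (\<Sum>j=1..s. b j *\<^sub>R Xis \<gamma> k j))
      + blinfun_apply (cmu \<gamma> (k + 1)) ((1 / h) *\<^sub>R dU k - (\<Sum>j=1..s. b j *\<^sub>R dXi k j))) (at 0)"
    if "k < N" for k
    using pairing_deriv[OF constraint_deriv[OF dU[OF that]]] by (simp add: gc0)
  have lin: "((\<lambda>t. blinfun_apply (n + t *\<^sub>R dn)
      ((1 / h) *\<^sub>R (x + t *\<^sub>R dx - (y + t *\<^sub>R dy)) - (\<Sum>j=1..s. w j *\<^sub>R (Vs \<gamma> k j + t *\<^sub>R dV k j))))
      has_real_derivative
      blinfun_apply dn ((1 / h) *\<^sub>R (x - y) - (\<Sum>j=1..s. w j *\<^sub>R Vs \<gamma> k j))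
      + blinfun_apply n ((1 / h) *\<^sub>R (dx - dy) - (\<Sum>j=1..s. w j *\<^sub>R dV k j))) (at 0)"
    for n dn x dx y dy w k
    unfolding dist
    using pairing_deriv[OF constraint_deriv[OF has_vector_derivative_line[of "x - y" "dx - dy" 0]]]
    by simp
  have "((\<lambda>t. action G D \<tau> l h N s a b (\<Gamma> t)) has_real_derivative h * ?S) (at 0)"
    unfolding action_def action_variation_def sel
    by (intro DERIV_cmult DERIV_sum DERIV_add lagrangian_deriv dl mu cm lin) auto
  then have "h * ?S = 0" using 0 DERIV_unique by blast
  then show ?thesis using h_pos by simp
qed

lemma const_curve: "curve_at A p (\<lambda>_. p)"
  by (simp add: curve_at_iff_mdiff mdiff_const)

section \<open>The discrete equations of motion\<close>

text \<open>With all \<open>g\<close>, \<open>Gs\<close> and \<open>xi\<close> at rest the end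
  conditions hold trivially, so each step can be varied alone, the first and the last included; the
  multipliers \<open>cmu\<close> and \<open>nu\<close> at index \<open>N\<close> are free as
  well.\<close>

lemma stage_variation:
  assumes k: "k < N"
  shows "(\<Sum>i=1..s. b i * (blinfun_apply (dl_dxi l (Xis \<gamma> k i) (Vs \<gamma> k i)) (dXi i)
                      + blinfun_apply (dl_du l (Xis \<gamma> k i) (Vs \<gamma> k i)) (dV i))
        + (blinfun_apply (dmu i) ((1 / h) *\<^sub>R inv_into D \<tau> (stage_arg k i) - (\<Sum>j=1..s. a i j *\<^sub>R Xis \<gamma> k j))
          - blinfun_apply (mus \<gamma> k i) (\<Sum>j=1..s. a i j *\<^sub>R dXi j))
        + (blinfun_apply (dnus i) ((1 / h) *\<^sub>R (Xis \<gamma> k i - xi \<gamma> k) - (\<Sum>j=1..s. a i j *\<^sub>R Vs \<gamma> k j))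
          + blinfun_apply (nus \<gamma> k i) ((1 / h) *\<^sub>R dXi i - (\<Sum>j=1..s. a i j *\<^sub>R dV j))))
      + (blinfun_apply dcmu ((1 / h) *\<^sub>R inv_into D \<tau> (node_arg k) - (\<Sum>i=1..s. b i *\<^sub>R Xis \<gamma> k i))
        - blinfun_apply (cmu \<gamma> (k + 1)) (\<Sum>i=1..s. b i *\<^sub>R dXi i))
      + (blinfun_apply dnu ((1 / h) *\<^sub>R (xi \<gamma> (k + 1) - xi \<gamma> k) - (\<Sum>i=1..s. b i *\<^sub>R Vs \<gamma> k i))
        - blinfun_apply (nu \<gamma> (k + 1)) (\<Sum>i=1..s. b i *\<^sub>R dV i)) = 0"
    (is "?R = 0")
proof -
  have "action_variation (\<lambda>_ _. 0) (\<lambda>_. 0) (\<lambda>_. 0)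
      (\<lambda>k'. if k' = k + 1 then dcmu else 0) (\<lambda>k'. if k' = k + 1 then dnu else 0)
      (\<lambda>k' i. if k' = k then dXi i else 0) (\<lambda>k' i. if k' = k then dV i else 0)
      (\<lambda>k' i. if k' = k then dmu i else 0) (\<lambda>k' i. if k' = k then dnus i else 0) = 0"
    by (rule first_variation[where gc = "\<lambda>k t. g \<gamma> k" and Gc = "\<lambda>k i t. Gs \<gamma> k i"])
      (auto simp: const_curve)
  then show ?thesis
    unfolding action_variation_def
    by (subst (asm) sum_eq_single[of _ k]) (simp_all add: k blinfun.minus_right)
qed

lemma stage_reconstruction:
  assumes k: "k < N" and i: "i \<in> {1..s}"
  shows "Xis \<gamma> k i = xi \<gamma> k + h *\<^sub>R (\<Sum>j=1..s. a i j *\<^sub>R Vs \<gamma> k j)"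
    and "inv_into D \<tau> (stage_arg k i) = h *\<^sub>R Theta a s \<gamma> k i"
    and "Gs \<gamma> k i = gmult G (g \<gamma> k) (\<tau> (h *\<^sub>R Theta a s \<gamma> k i))"
proof -
  have "(1 / h) *\<^sub>R inv_into D \<tau> (stage_arg k i) - (\<Sum>j=1..s. a i j *\<^sub>R Xis \<gamma> k j) = 0" (is "?x = 0")
  proof (rule blinfun_separates_points)
    fix m :: "'g \<Rightarrow>\<^sub>L real"
    have "(\<Sum>i'=1..s. blinfun_apply (if i' = i then m else 0)
        ((1 / h) *\<^sub>R inv_into D \<tau> (stage_arg k i') - (\<Sum>j=1..s. a i' j *\<^sub>R Xis \<gamma> k j))) = 0"
      using stage_variation[OF k, of "\<lambda>_. 0" "\<lambda>_. 0" "\<lambda>i'. if i' = i then m else 0" "\<lambda>_. 0" 0 0]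
      by simp
    then show "blinfun_apply m ?x = 0"
      by (subst (asm) sum_eq_single[of _ i]) (use i in simp_all)
  qed
  then have "h *\<^sub>R ((1 / h) *\<^sub>R inv_into D \<tau> (stage_arg k i)) = h *\<^sub>R Theta a s \<gamma> k i" by (simp add: Theta_def)
  then show arg: "inv_into D \<tau> (stage_arg k i) = h *\<^sub>R Theta a s \<gamma> k i" using h_pos by simp
  \<comment> \<open>The equation for \<open>inv_into\<close> becomes an equation in the group only
    where its argument lies in the image of \<open>\<tau>\<close>.\<close>
  have "stage_arg k i \<in> \<tau> ` D" using domain k i by (auto simp: arguments_in_domain_def)
  then have "\<tau> (h *\<^sub>R Theta a s \<gamma> k i) = stage_arg k i" unfolding arg[symmetric] by (rule f_inv_into_f)
  then show "Gs \<gamma> k i = gmult G (g \<gamma> k) (\<tau> (h *\<^sub>R Theta a s \<gamma> k i))"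
    by (simp add: assoc[symmetric] group_left_neutral)
  have "(1 / h) *\<^sub>R (Xis \<gamma> k i - xi \<gamma> k) - (\<Sum>j=1..s. a i j *\<^sub>R Vs \<gamma> k j) = 0" (is "?y = 0")
  proof (rule blinfun_separates_points)
    fix m :: "'g \<Rightarrow>\<^sub>L real"
    have "(\<Sum>i'=1..s. blinfun_apply (if i' = i then m else 0)
        ((1 / h) *\<^sub>R (Xis \<gamma> k i' - xi \<gamma> k) - (\<Sum>j=1..s. a i' j *\<^sub>R Vs \<gamma> k j))) = 0"
      using stage_variation[OF k, of "\<lambda>_. 0" "\<lambda>_. 0" "\<lambda>_. 0" "\<lambda>i'. if i' = i then m else 0" 0 0]
      by simp
    then show "blinfun_apply m ?y = 0"
      by (subst (asm) sum_eq_single[of _ i]) (use i in simp_all)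
  qed
  then have "h *\<^sub>R ((1 / h) *\<^sub>R (Xis \<gamma> k i - xi \<gamma> k)) = h *\<^sub>R (\<Sum>j=1..s. a i j *\<^sub>R Vs \<gamma> k j)" by simp
  then have "Xis \<gamma> k i - xi \<gamma> k = h *\<^sub>R (\<Sum>j=1..s. a i j *\<^sub>R Vs \<gamma> k j)" using h_pos by simp
  then show "Xis \<gamma> k i = xi \<gamma> k + h *\<^sub>R (\<Sum>j=1..s. a i j *\<^sub>R Vs \<gamma> k j)" by (simp add: algebra_simps)
qed

lemma node_reconstruction:
  assumes k: "k < N"
  shows "xi \<gamma> (k + 1) = xi \<gamma> k + h *\<^sub>R (\<Sum>j=1..s. b j *\<^sub>R Vs \<gamma> k j)"
    and "g \<gamma> (k + 1) = gmult G (g \<gamma> k) (\<tau> (h *\<^sub>R Xi_node b s \<gamma> (k + 1)))"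
proof -
  have "(1 / h) *\<^sub>R inv_into D \<tau> (node_arg k) - (\<Sum>j=1..s. b j *\<^sub>R Xis \<gamma> k j) = 0"
    by (rule blinfun_separates_points)
      (use stage_variation[OF k, of "\<lambda>_. 0" "\<lambda>_. 0" "\<lambda>_. 0" "\<lambda>_. 0" _ 0] in simp)
  then have "h *\<^sub>R ((1 / h) *\<^sub>R inv_into D \<tau> (node_arg k)) = h *\<^sub>R Xi_node b s \<gamma> (k + 1)" by (simp add: Xi_node_def)
  then have arg: "inv_into D \<tau> (node_arg k) = h *\<^sub>R Xi_node b s \<gamma> (k + 1)" using h_pos by simp
  have "node_arg k \<in> \<tau> ` D" using domain k by (auto simp: arguments_in_domain_def)
  then have "\<tau> (h *\<^sub>R Xi_node b s \<gamma> (k + 1)) = node_arg k" unfolding arg[symmetric] by (rule f_inv_into_f)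
  then show "g \<gamma> (k + 1) = gmult G (g \<gamma> k) (\<tau> (h *\<^sub>R Xi_node b s \<gamma> (k + 1)))"
    by (simp add: assoc[symmetric] group_left_neutral)
  have "(1 / h) *\<^sub>R (xi \<gamma> (k + 1) - xi \<gamma> k) - (\<Sum>j=1..s. b j *\<^sub>R Vs \<gamma> k j) = 0"
    by (rule blinfun_separates_points)
      (use stage_variation[OF k, of "\<lambda>_. 0" "\<lambda>_. 0" "\<lambda>_. 0" "\<lambda>_. 0" 0] in simp)
  then have "h *\<^sub>R ((1 / h) *\<^sub>R (xi \<gamma> (k + 1) - xi \<gamma> k)) = h *\<^sub>R (\<Sum>j=1..s. b j *\<^sub>R Vs \<gamma> k j)" by simp
  then have "xi \<gamma> (k + 1) - xi \<gamma> k = h *\<^sub>R (\<Sum>j=1..s. b j *\<^sub>R Vs \<gamma> k j)" using h_pos by simp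
  then show "xi \<gamma> (k + 1) = xi \<gamma> k + h *\<^sub>R (\<Sum>j=1..s. b j *\<^sub>R Vs \<gamma> k j)" by (simp add: algebra_simps)
qed

lemma tau_inv_line:
  assumes "\<xi> \<in> D"
  shows "((\<lambda>t. inv_into D \<tau> (\<tau> (\<xi> + t *\<^sub>R v))) has_vector_derivative v) (at 0)"
proof -
  have line: "((\<lambda>t. \<xi> + t *\<^sub>R v) has_vector_derivative v) (at 0)" by (rule has_vector_derivative_line)
  have "\<forall>\<^sub>F t in nhds 0. \<xi> + t *\<^sub>R v \<in> D"
    using assms by (intro eventually_in_open[OF _ open_D] has_vector_derivative_continuous[OF line]) simp
  then have "\<forall>\<^sub>F t in at 0. \<xi> + t *\<^sub>R v = inv_into D \<tau> (\<tau> (\<xi> + t *\<^sub>R v))"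
    unfolding eventually_at_filter by eventually_elim simp
  from has_derivative_transform_eventually[OF line[unfolded has_vector_derivative_def] this]
  show ?thesis using assms by (simp add: has_vector_derivative_def)
qed

lemma tau_line_curve:
  assumes "\<xi> \<in> D"
  shows "curve_at (atlas G) (gmult G x (\<tau> \<xi>)) (\<lambda>t. gmult G x (\<tau> (\<xi> + t *\<^sub>R v)))"
proof -
  have "(\<lambda>t. \<xi> + t *\<^sub>R v) differentiable (at 0)"
    using has_vector_derivative_line differentiableI_vector by blast
  then have "mdiff (atlas G) (\<tau> \<circ> (\<lambda>t. \<xi> + t *\<^sub>R v)) 0"
    using mdiff_tau[OF assms] by (intro mdiff_compose_vec) simp_all
  then show ?thesis
    by (simp add: curve_at_iff_mdiff o_def mdiff_mult mdiff_const)
qed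

lemma cancel_left: "gmult G (ginv G x) (gmult G x y) = y"
  by (simp add: assoc[symmetric] group_left_neutral)

text \<open>Moving \<open>G\<^sub>k\<^sup>i\<close> along \<open>g\<^sub>k \<tau>(h \<Theta>\<^sub>k\<^sup>i + t v)\<close> makes \<open>\<tau>\<^sup>-\<^sup>1(g\<^sub>k\<^sup>-\<^sup>1 G\<^sub>k\<^sup>i)\<close> affine in \<open>t\<close>.\<close>

lemma mus_zero:
  assumes k: "k < N" and i: "i \<in> {1..s}"
  shows "mus \<gamma> k i = 0"
proof (rule blinfun_eqI)
  fix v :: 'g
  define \<xi> where "\<xi> = h *\<^sub>R Theta a s \<gamma> k i"
  have \<xi>: "\<xi> \<in> D" using domain k i by (auto simp: arguments_in_domain_def \<xi>_def)
  have Gki: "Gs \<gamma> k i = gmult G (g \<gamma> k) (\<tau> \<xi>)"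
    unfolding \<xi>_def by (rule stage_reconstruction(3)[OF k i])
  have "action_variation (\<lambda>k' i'. if k' = k \<and> i' = i then v else 0) (\<lambda>_. 0) (\<lambda>_. 0)
      (\<lambda>_. 0) (\<lambda>_. 0) (\<lambda>_ _. 0) (\<lambda>_ _. 0) (\<lambda>_ _. 0) (\<lambda>_ _. 0) = 0"
  proof (rule first_variation[where gc = "\<lambda>k t. g \<gamma> k"
        and Gc = "\<lambda>k' i' t. if k' = k \<and> i' = i then gmult G (g \<gamma> k) (\<tau> (\<xi> + t *\<^sub>R v)) else Gs \<gamma> k' i'"])
    fix k' i'
    show "curve_at (atlas G) (Gs \<gamma> k' i')
        (\<lambda>t. if k' = k \<and> i' = i then gmult G (g \<gamma> k) (\<tau> (\<xi> + t *\<^sub>R v)) else Gs \<gamma> k' i')"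
      using tau_line_curve[OF \<xi>] by (cases "k' = k \<and> i' = i") (auto simp: Gki const_curve)
    show "((\<lambda>t. inv_into D \<tau> (gmult G (ginv G (g \<gamma> k'))
        (if k' = k \<and> i' = i then gmult G (g \<gamma> k) (\<tau> (\<xi> + t *\<^sub>R v)) else Gs \<gamma> k' i')))
        has_vector_derivative (if k' = k \<and> i' = i then v else 0)) (at 0)"
      using tau_inv_line[OF \<xi>] by (cases "k' = k \<and> i' = i") (auto simp: cancel_left)
  qed (auto simp: const_curve)
  then have "(\<Sum>k'<N. \<Sum>i'=1..s. blinfun_apply (mus \<gamma> k' i') ((1 / h) *\<^sub>R (if k' = k \<and> i' = i then v else 0))) = 0"
    by (simp add: action_variation_def)
  then have "(\<Sum>i'=1..s. blinfun_apply (mus \<gamma> k i') ((1 / h) *\<^sub>R (if i' = i then v else 0))) = 0"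
    by (subst (asm) sum_eq_single[of _ k]) (simp_all add: k)
  then have "blinfun_apply (mus \<gamma> k i) ((1 / h) *\<^sub>R v) = 0"
    by (subst (asm) sum_eq_single[of _ i]) (use i in simp_all)
  then show "blinfun_apply (mus \<gamma> k i) v = blinfun_apply 0 v"
    using h_pos by (simp add: blinfun.scaleR_right)
qed

text \<open>For \<open>k = 0\<close> this is the definition of \<open>nu_node\<close> at 0. For
  \<open>k > 0\<close> the node is interior and \<open>\<xi>\<^sub>k\<close> may be varied alone,
  which meets two consecutive steps.\<close>

lemma nu_recursion:
  assumes k: "k < N"
  shows "nu_node s \<gamma> (k + 1) = nu_node s \<gamma> k - (\<Sum>j=1..s. nus \<gamma> k j)"
proof (cases k)
  case 0
  then show ?thesis by (simp add: nu_node_def)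
next
  case (Suc k0)
  have "nu \<gamma> k = nu \<gamma> (k + 1) + (\<Sum>j=1..s. nus \<gamma> k j)"
  proof (rule blinfun_eqI)
    fix v :: 'g
    \<comment> \<open>The factor \<open>h\<close> in the variation cancels the \<open>1 / h\<close>
      of the constraints.\<close>
    have "action_variation (\<lambda>_ _. 0) (\<lambda>_. 0) (\<lambda>k'. if k' = k then h *\<^sub>R v else 0)
        (\<lambda>_. 0) (\<lambda>_. 0) (\<lambda>_ _. 0) (\<lambda>_ _. 0) (\<lambda>_ _. 0) (\<lambda>_ _. 0) = 0"
      by (rule first_variation[where gc = "\<lambda>k t. g \<gamma> k" and Gc = "\<lambda>k i t. Gs \<gamma> k i"])
        (use k Suc in \<open>auto simp: const_curve\<close>)
    then show "blinfun_apply (nu \<gamma> k) v = blinfun_apply (nu \<gamma> (k + 1) + (\<Sum>j=1..s. nus \<gamma> k j)) v"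
      unfolding action_variation_def
      by (subst (asm) sum_eq_pair[of k0])
        (use k Suc h_pos in \<open>simp_all add: blinfun.scaleR_right blinfun.minus_right blinfun.add_left blinfun.sum_left sum_negf\<close>)
  qed
  then show ?thesis using Suc by (simp add: nu_node_def)
qed

text \<open>Only \<open>\<Xi>\<^sub>k\<^sup>i\<close> is varied. It enters the position constraint
  of every stage, but these drop out with the \<open>mus\<close>; what remains is a multiple of
  \<open>b i\<close>, apart from the term in \<open>nus\<close>. The multiplier \<open>cmu\<close>
  is expressed by \<open>mu_node\<close> later.\<close>

lemma dl_dxi_equation:
  assumes k: "k < N" and i: "i \<in> {1..s}"
  shows "dl_dxi l (Xis \<gamma> k i) (Vs \<gamma> k i) = cmu \<gamma> (k + 1) - (1 / (h * b i)) *\<^sub>R nus \<gamma> k i"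
proof (rule blinfun_eqI)
  fix v :: 'g
  have bi: "b i \<noteq> 0" using i by (rule b_nonzero)
  have "(\<Sum>j=1..s. b j *\<^sub>R (if j = i then v else 0)) = b i *\<^sub>R v"
    by (subst sum_eq_single[of _ i]) (use i in simp_all)
  moreover have "(\<Sum>i'=1..s. b i' * blinfun_apply (dl_dxi l (Xis \<gamma> k i') (Vs \<gamma> k i')) (if i' = i then v else 0)
      + blinfun_apply (nus \<gamma> k i') ((1 / h) *\<^sub>R (if i' = i then v else 0)))
    = b i * blinfun_apply (dl_dxi l (Xis \<gamma> k i) (Vs \<gamma> k i)) v + blinfun_apply (nus \<gamma> k i) ((1 / h) *\<^sub>R v)"
    by (subst sum_eq_single[of _ i]) (use i in simp_all)
  ultimately have "b i * blinfun_apply (dl_dxi l (Xis \<gamma> k i) (Vs \<gamma> k i)) v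
      + blinfun_apply (nus \<gamma> k i) ((1 / h) *\<^sub>R v) - blinfun_apply (cmu \<gamma> (k + 1)) (b i *\<^sub>R v) = 0"
    using stage_variation[OF k, of "\<lambda>j. if j = i then v else 0" "\<lambda>_. 0" "\<lambda>_. 0" "\<lambda>_. 0" 0 0]
    by (simp add: mus_zero[OF k])
  then have "b i * blinfun_apply (dl_dxi l (Xis \<gamma> k i) (Vs \<gamma> k i)) v
      = b i * (blinfun_apply (cmu \<gamma> (k + 1)) v - (1 / (h * b i)) * blinfun_apply (nus \<gamma> k i) v)"
    using bi by (simp add: blinfun.scaleR_right right_diff_distrib)
  then show "blinfun_apply (dl_dxi l (Xis \<gamma> k i) (Vs \<gamma> k i)) v
      = blinfun_apply (cmu \<gamma> (k + 1) - (1 / (h * b i)) *\<^sub>R nus \<gamma> k i) v"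
    using bi by (simp add: blinfun.diff_left blinfun.scaleR_left)
qed

text \<open>\<open>V\<^sub>k\<^sup>i\<close> enters the velocity constraint of every stage
  \<open>j\<close> with weight \<open>a j i\<close>, hence the transposed coefficients. The
  variation yields \<open>nu\<close> at \<open>k + 1\<close>; replacing it by the recursion produces
  the \<open>- 1\<close> in each coefficient.\<close>

lemma dl_du_equation:
  assumes k: "k < N" and i: "i \<in> {1..s}"
  shows "dl_du l (Xis \<gamma> k i) (Vs \<gamma> k i) = (\<Sum>j=1..s. (a j i / b i - 1) *\<^sub>R nus \<gamma> k j) + nu_node s \<gamma> k"
proof (rule blinfun_eqI)
  fix v :: 'g
  have bi: "b i \<noteq> 0" using i by (rule b_nonzero)
  have sing: "(\<Sum>j=1..s. w j *\<^sub>R (if j = i then v else 0)) = w i *\<^sub>R v" for w :: "nat \<Rightarrow> real"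
    by (subst sum_eq_single[of _ i]) (use i in simp_all)
  have "(\<Sum>i'=1..s. b i' * blinfun_apply (dl_du l (Xis \<gamma> k i') (Vs \<gamma> k i')) (if i' = i then v else 0))
    = b i * blinfun_apply (dl_du l (Xis \<gamma> k i) (Vs \<gamma> k i)) v"
    by (subst sum_eq_single[of _ i]) (use i in simp_all)
  then have "b i * blinfun_apply (dl_du l (Xis \<gamma> k i) (Vs \<gamma> k i)) v
      - (\<Sum>j=1..s. a j i * blinfun_apply (nus \<gamma> k j) v) - b i * blinfun_apply (nu \<gamma> (k + 1)) v = 0"
    using stage_variation[OF k, of "\<lambda>_. 0" "\<lambda>j. if j = i then v else 0" "\<lambda>_. 0" "\<lambda>_. 0" 0 0]
    by (simp add: sing[unfolded One_nat_def] sum.distrib sum_negf sum_subtractf blinfun.scaleR_right blinfun.minus_right)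
  then have "blinfun_apply (dl_du l (Xis \<gamma> k i) (Vs \<gamma> k i)) v
      = (\<Sum>j=1..s. a j i * blinfun_apply (nus \<gamma> k j) v) / b i + blinfun_apply (nu \<gamma> (k + 1)) v"
    using bi by (simp add: field_simps)
  moreover have "nu \<gamma> (k + 1) = nu_node s \<gamma> k - (\<Sum>j=1..s. nus \<gamma> k j)"
    using nu_recursion[OF k] by (simp add: nu_node_def)
  ultimately show "blinfun_apply (dl_du l (Xis \<gamma> k i) (Vs \<gamma> k i)) v
      = blinfun_apply ((\<Sum>j=1..s. (a j i / b i - 1) *\<^sub>R nus \<gamma> k j) + nu_node s \<gamma> k) v"
    by (simp add: blinfun.add_left blinfun.diff_left blinfun.sum_left blinfun.scaleR_left
        left_diff_distrib sum_subtractf sum_divide_distrib)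
qed

section \<open>Momenta on the two sides of a node and the discrete Euler-Poincare equation\<close>

lemma node_domain:
  "k < N \<Longrightarrow> h *\<^sub>R Xi_node b s \<gamma> (k + 1) \<in> D"
  "k < N \<Longrightarrow> - (h *\<^sub>R Xi_node b s \<gamma> (k + 1)) \<in> D"
  using domain by (auto simp: arguments_in_domain_def)

text \<open>Moving \<open>g\<^sub>k\<close> along \<open>g\<^sub>k\<^sub>-\<^sub>1 \<tau>(h \<Xi>\<^sub>k + t v)\<close> makes \<open>\<tau>\<^sup>-\<^sup>1(g\<^sub>k\<^sub>-\<^sub>1\<^sup>-\<^sup>1 g\<^sub>k)\<close> affine in \<open>t\<close>; the derivative of
  \<open>\<tau>\<^sup>-\<^sup>1(g\<^sub>k\<^sup>-\<^sup>1 g\<^sub>k\<^sub>+\<^sub>1)\<close> is then the one in \<open>tau_inv_shift_derivative\<close>. The terms in \<open>\<mu>\<^sub>k\<^sup>i\<close> drop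
  out because these multipliers are already known to vanish.\<close>

lemma momentum_matching:
  assumes k: "Suc k < N"
  shows "blinfun_apply (cmu \<gamma> (Suc k)) v = blinfun_apply (cmu \<gamma> (Suc (Suc k)))
    (dtau_inv G \<theta> \<tau> (h *\<^sub>R Xi_node b s \<gamma> (Suc (Suc k))) (dtau G \<theta> \<tau> (- (h *\<^sub>R Xi_node b s \<gamma> (Suc k))) v))"
proof -
  define \<xi> where "\<xi> = h *\<^sub>R Xi_node b s \<gamma> (Suc k)"
  define \<zeta> where "\<zeta> = h *\<^sub>R Xi_node b s \<gamma> (Suc (Suc k))"
  define w where "w = dtau_inv G \<theta> \<tau> \<zeta> (dtau G \<theta> \<tau> (- \<xi>) v)"
  have dom: "\<xi> \<in> D" "- \<xi> \<in> D" "\<zeta> \<in> D"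
    using node_domain[of k] node_domain[of "Suc k"] k by (auto simp: \<xi>_def \<zeta>_def)
  have g1: "g \<gamma> (Suc k) = gmult G (g \<gamma> k) (\<tau> \<xi>)"
    and g2: "g \<gamma> (Suc (Suc k)) = gmult G (gmult G (g \<gamma> k) (\<tau> \<xi>)) (\<tau> \<zeta>)"
    using node_reconstruction(2)[of k] node_reconstruction(2)[of "Suc k"] k by (simp_all add: \<xi>_def \<zeta>_def)
  define c where "c t = gmult G (g \<gamma> k) (\<tau> (\<xi> + t *\<^sub>R v))" for t :: real
  have c: "curve_at (atlas G) (g \<gamma> (Suc k)) c"
    unfolding c_def g1 by (rule tau_line_curve[OF dom(1)])
  \<comment> \<open>Moving the node also moves the stage terms of the next step. Only the existence
    of their derivatives matters, since their values are paired with the vanishing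
    \<open>mus\<close>.\<close>
  have "\<exists>z. ((\<lambda>t. inv_into D \<tau> (gmult G (ginv G (c t)) (Gs \<gamma> (Suc k) i))) has_vector_derivative z) (at 0)"
    if i: "i \<in> {1..s}" for i
  proof -
    have "mdiff (atlas G) (\<lambda>t. gmult G (ginv G (c t)) (Gs \<gamma> (Suc k) i)) 0"
      using c by (intro mdiff_mult mdiff_inv mdiff_const) (simp add: curve_at_iff_mdiff)
    moreover have "gmult G (ginv G (c 0)) (Gs \<gamma> (Suc k) i) \<in> \<tau> ` D"
      using c domain i k by (auto simp: curve_at_def arguments_in_domain_def)
    ultimately show ?thesis using differentiable_tau_inv vector_derivative_works by blast
  qed
  then obtain z where z: "\<And>i. i \<in> {1..s} \<Longrightarrow>
    ((\<lambda>t. inv_into D \<tau> (gmult G (ginv G (c t)) (Gs \<gamma> (Suc k) i))) has_vector_derivative z i) (at 0)"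
    by metis
  \<comment> \<open>The node term has derivative \<open>v\<close> in the step that ends at the moved
    node and \<open>- w\<close> in the step that starts there.\<close>
  have "action_variation (\<lambda>k' i'. if k' = Suc k then z i' else 0)
      (\<lambda>k'. if k' = k then v else if k' = Suc k then - w else 0) (\<lambda>_. 0)
      (\<lambda>_. 0) (\<lambda>_. 0) (\<lambda>_ _. 0) (\<lambda>_ _. 0) (\<lambda>_ _. 0) (\<lambda>_ _. 0) = 0"
  proof (rule first_variation[where gc = "\<lambda>k' t. if k' = Suc k then c t else g \<gamma> k'"
        and Gc = "\<lambda>k i t. Gs \<gamma> k i"])
    fix k'
    show "curve_at (atlas G) (g \<gamma> k') (\<lambda>t. if k' = Suc k then c t else g \<gamma> k')"
      using c by (cases "k' = Suc k") (simp_all add: const_curve)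
    show "((\<lambda>t. inv_into D \<tau> (gmult G (ginv G (if k' = Suc k then c t else g \<gamma> k')) (Gs \<gamma> k' i)))
        has_vector_derivative (if k' = Suc k then z i else 0)) (at 0)" if "i \<in> {1..s}" for i
      using z[OF that] by (cases "k' = Suc k") simp_all
    consider "k' = k" | "k' = Suc k" | "k' \<noteq> k" "k' \<noteq> Suc k" by blast
    then show "((\<lambda>t. inv_into D \<tau> (gmult G (ginv G (if k' = Suc k then c t else g \<gamma> k'))
        (if k' + 1 = Suc k then c t else g \<gamma> (k' + 1))))
        has_vector_derivative (if k' = k then v else if k' = Suc k then - w else 0)) (at 0)"
    proof cases
      case 1
      then show ?thesis using tau_inv_line[OF dom(1)] by (simp add: c_def cancel_left)
    next
      case 2
      have "gmult G (ginv G (c t)) (g \<gamma> (Suc (Suc k)))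
          = gmult G (ginv G (\<tau> (\<xi> + t *\<^sub>R v))) (gmult G (\<tau> \<xi>) (\<tau> \<zeta>))" for t
        by (simp add: c_def g2 inverse_distrib_swap assoc cancel_left)
      then show ?thesis using 2 tau_inv_shift_derivative[OF dom, of v] by (simp add: w_def)
    next
      case 3
      then show ?thesis by simp
    qed
  qed (use k in \<open>auto simp: const_curve\<close>)
  then show ?thesis
    unfolding action_variation_def
    by (subst (asm) sum_eq_pair[OF k])
      (use k h_pos in \<open>simp_all add: mus_zero blinfun.scaleR_right blinfun.minus_right w_def \<xi>_def \<zeta>_def\<close>)
qed

text \<open>For \<open>k > 0\<close> the definition of \<open>mu_node\<close> uses the step that
  ends at \<open>k\<close>; this form uses the step that starts there. They agree by
  \<open>momentum_matching\<close> at \<open>dtau_inv\<close> of \<open>v\<close>, which cancels the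
  inner \<open>dtau\<close>. At \<open>k = 0\<close> the definition already looks forward, and its
  extra stage terms vanish with the \<open>mus\<close>.\<close>

lemma mu_node_eq:
  assumes k: "k < N"
  shows "mu_node G \<theta> \<tau> h s a b \<gamma> k = dual_map (dtau_inv G \<theta> \<tau> (h *\<^sub>R Xi_node b s \<gamma> (k + 1))) (cmu \<gamma> (k + 1))"
proof (cases k)
  case 0
  have "dual_map f 0 = 0" for f :: "'g \<Rightarrow> 'g" by (simp add: dual_map_def flip: zero_blinfun_def)
  then show ?thesis using k 0 by (simp add: mu_node_def mus_zero)
next
  case (Suc k0)
  show ?thesis
  proof (rule blinfun_eqI)
    fix v :: 'g
    have "- (h *\<^sub>R Xi_node b s \<gamma> (Suc k0)) \<in> D" "h *\<^sub>R Xi_node b s \<gamma> (Suc (Suc k0)) \<in> D"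
      using node_domain(2)[of k0] node_domain(1)[of "Suc k0"] k Suc by auto
    then show "blinfun_apply (mu_node G \<theta> \<tau> h s a b \<gamma> k) v
        = blinfun_apply (dual_map (dtau_inv G \<theta> \<tau> (h *\<^sub>R Xi_node b s \<gamma> (k + 1))) (cmu \<gamma> (k + 1))) v"
      using momentum_matching[of k0] k Suc by (simp add: mu_node_def dual_map_apply linear_dtau_inv)
  qed
qed

text \<open>One multiplier belongs to each step, and it is expressed here by the momentum at either
  end. Eliminating it between the two expressions gives the discrete Euler-Poincare
  equation.\<close>

lemma cmu_eq_mu_node:
  assumes k: "k < N"
  shows "cmu \<gamma> (k + 1) = dual_map (dtau G \<theta> \<tau> (- (h *\<^sub>R Xi_node b s \<gamma> (k + 1)))) (mu_node G \<theta> \<tau> h s a b \<gamma> (k + 1))"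
    and "cmu \<gamma> (k + 1) = dual_map (dtau G \<theta> \<tau> (h *\<^sub>R Xi_node b s \<gamma> (k + 1))) (mu_node G \<theta> \<tau> h s a b \<gamma> k)"
proof -
  have cancel: "dual_map (dtau G \<theta> \<tau> \<xi>) (dual_map (dtau_inv G \<theta> \<tau> \<xi>) m) = m" if "\<xi> \<in> D" for \<xi> m
    using that by (intro blinfun_eqI) (simp add: dual_map_apply linear_dtau linear_dtau_inv)
  have "mu_node G \<theta> \<tau> h s a b \<gamma> (k + 1)
      = dual_map (dtau_inv G \<theta> \<tau> (- (h *\<^sub>R Xi_node b s \<gamma> (k + 1)))) (cmu \<gamma> (k + 1))"
    by (simp add: mu_node_def)
  then show "cmu \<gamma> (k + 1) = dual_map (dtau G \<theta> \<tau> (- (h *\<^sub>R Xi_node b s \<gamma> (k + 1)))) (mu_node G \<theta> \<tau> h s a b \<gamma> (k + 1))"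
    using cancel[OF node_domain(2)[OF k]] by simp
  show "cmu \<gamma> (k + 1) = dual_map (dtau G \<theta> \<tau> (h *\<^sub>R Xi_node b s \<gamma> (k + 1))) (mu_node G \<theta> \<tau> h s a b \<gamma> k)"
    using cancel[OF node_domain(1)[OF k]] by (simp add: mu_node_eq[OF k])
qed

lemma dl_dxi_momentum:
  assumes k: "k < N" and i: "i \<in> {1..s}"
  shows "dl_dxi l (Xis \<gamma> k i) (Vs \<gamma> k i)
    = dual_map (dtau G \<theta> \<tau> (- (h *\<^sub>R Xi_node b s \<gamma> (k + 1)))) (mu_node G \<theta> \<tau> h s a b \<gamma> (k + 1))
      - (1 / (h * b i)) *\<^sub>R nus \<gamma> k i"
  unfolding cmu_eq_mu_node(1)[OF k, symmetric] by (rule dl_dxi_equation[OF k i])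

lemma discrete_euler_poincare:
  assumes k: "k < N"
  shows "mu_node G \<theta> \<tau> h s a b \<gamma> (k + 1) = dual_map (dtau_inv G \<theta> \<tau> (- (h *\<^sub>R Xi_node b s \<gamma> (k + 1))))
    (dual_map (dtau G \<theta> \<tau> (h *\<^sub>R Xi_node b s \<gamma> (k + 1))) (mu_node G \<theta> \<tau> h s a b \<gamma> k))"
  unfolding cmu_eq_mu_node(2)[OF k, symmetric] by (simp add: mu_node_def)

end

theorem mainTheorem4:
  fixes G :: "('a::{t2_space, second_countable_topology}, 'e::real_normed_vector) lie_data"
    and \<theta> :: "'g::real_normed_vector \<Rightarrow> (real \<Rightarrow> 'a) set"
    and D :: "'g set" and \<tau> :: "'g \<Rightarrow> 'a"
    and l :: "'g \<times> 'g \<Rightarrow> real"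
    and h :: real and N s :: nat
    and a :: "nat \<Rightarrow> nat \<Rightarrow> real" and b :: "nat \<Rightarrow> real"
    and \<gamma> :: "('a, 'g) path"
  assumes "lie_group Smooth G" and "lie_algebra_iso G \<theta>"
    and "smooth_map_on UNIV l"
    and "h > 0" and "N \<ge> 1"
    and "\<forall>i\<in>{1..s}. b i \<noteq> 0"
    and "local_exp_approx G D \<tau>"
    and "arguments_in_domain G D \<tau> h N s a b \<gamma>"
    and "discrete_HOHP_solution G D \<tau> l h N s a b \<gamma>"
  shows "\<forall>k<N.
      (\<forall>i\<in>{1..s}.
          Xis \<gamma> k i = xi \<gamma> k + h *\<^sub>R (\<Sum>j=1..s. a i j *\<^sub>R Vs \<gamma> k j)
        \<and> Gs \<gamma> k i = gmult G (g \<gamma> k) (\<tau> (h *\<^sub>R (\<Sum>j=1..s. a i j *\<^sub>R Xis \<gamma> k j))))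
    \<and> xi \<gamma> (k + 1) = xi \<gamma> k + h *\<^sub>R (\<Sum>j=1..s. b j *\<^sub>R Vs \<gamma> k j)
    \<and> g \<gamma> (k + 1) = gmult G (g \<gamma> k) (\<tau> (h *\<^sub>R (\<Sum>j=1..s. b j *\<^sub>R Xis \<gamma> k j)))
    \<and> (\<forall>i\<in>{1..s}. mus \<gamma> k i = 0)
    \<and> nu_node s \<gamma> (k + 1) = nu_node s \<gamma> k - (\<Sum>j=1..s. nus \<gamma> k j)
    \<and> (\<forall>i\<in>{1..s}.
          dl_dxi l (Xis \<gamma> k i) (Vs \<gamma> k i)
            = dual_map (dtau G \<theta> \<tau> (- (h *\<^sub>R Xi_node b s \<gamma> (k + 1))))
                (mu_node G \<theta> \<tau> h s a b \<gamma> (k + 1))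
              - (1 / (h * b i)) *\<^sub>R nus \<gamma> k i
        \<and> dl_du l (Xis \<gamma> k i) (Vs \<gamma> k i)
            = (\<Sum>j=1..s. (a j i / b i - 1) *\<^sub>R nus \<gamma> k j) + nu_node s \<gamma> k)
    \<and> mu_node G \<theta> \<tau> h s a b \<gamma> (k + 1)
        = dual_map (dtau_inv G \<theta> \<tau> (- (h *\<^sub>R Xi_node b s \<gamma> (k + 1))))
            (dual_map (dtau G \<theta> \<tau> (h *\<^sub>R Xi_node b s \<gamma> (k + 1)))
              (mu_node G \<theta> \<tau> h s a b \<gamma> k))"
proof -
  interpret hohp_solution G \<theta> D \<tau> l h N s a b \<gamma>
    using assms by unfold_locales auto
  \<comment> \<open>\<open>Xi_node\<close> at index \<open>k + 1\<close> sums the stages of step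
    \<open>(k + 1) - 1\<close>, which has to be simplified to \<open>k\<close> to match the stated
    sum.\<close>
  show ?thesis
    by (intro allI impI conjI ballI)
      (rule stage_reconstruction(1) stage_reconstruction(3)[unfolded Theta_def] node_reconstruction(1)
        node_reconstruction(2)[unfolded Xi_node_def add_diff_cancel_right'] mus_zero nu_recursion
        dl_dxi_momentum dl_du_equation discrete_euler_poincare; assumption)+
qed

end
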